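(* Let $G$ be the universal covering group of $G_0 = PU(1,1)$. Then the geometric order, the Lie semigroup order and the maximal order on $G$ coincide; that is, $$\{g\in G \mid \forall x\in\mathbb{R}:\ g.x\ge x\} \;=\; G^+ \;=\; G^+_{\max},$$ where $G^+$ and $G^+_{\max}$ denote the order semigroups of the Lie semigroup order and the maximal order. In particular, the Lie semigroup $G^+$ is a maximal conjugation-invariant subsemigroup of $G$ (there is no conjugation-invariant subsemigroup $S$ of $G$ with $G^+\subsetneq S\subsetneq G$), and it can be described by a single continuous function (there is a continuous function $f:G\to\mathbb{R}$ with $G^+ = \{g\in G\mid \forall h\in G:\ f(hg)\ge f(h)\}$).
   Context: $G_0=PU(1,1)$ is the group of biholomorphic automorphisms of the Poincar\'e disc. Its action on the disc by rational linear transformations extends to the boundary circle $S^1\cong\mathbb{R}/\mathbb{Z}$, and this boundary action lifts to an action of the universal covering group $G$ on $\mathbb{R}$ by increasing homeomorphisms commuting with integer translations. A bi-invariant partial order $\le$ on $G$ is a partial order such that $g\le h$ implies $kg\le kh$ and $gk\le hk$ for all $g,h,k\in G$; it is uniquely determined by its order semigroup $\{g\in G\mid g\ge e\}$. Geometric order: $g\ge h$ iff $g.x\ge h.x$ for all $x\in\mathbb{R}$. Lie semigroup order: the Lie algebra $\mathfrak g$ of $G$ has a unique pair $\pm C$ of nonzero $\mathrm{Ad}$-invariant closed pointed convex cones; $C$ denotes the one with $\exp(C)$ contained in the order semigroup of the geometric order. The Lie semigroup order has as order semigroup $G^+$ the closure of the subsemigroup of $G$ generated by $\exp(C)$. Maximal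 order: the translation number is the continuous function $T:G\to\mathbb{R}$, $T(g)=\lim_{n\to\infty}\frac{g^n.x-x}{n}$ (independent of $x\in\mathbb{R}$). The maximal order has order semigroup $G^+_{\max}=\{g\in G\mid\forall h\in G:\ T(hg)\ge T(h)\}$. *)

theory Defs
  imports "HOL-Analysis.Analysis" "HOL-Algebra.Coset"
begin

definition mat_adj :: "complex^2^2 \<Rightarrow> complex^2^2" where
  "mat_adj A = (\<chi> i j. cnj (A $ j $ i))"

definition J11 :: "complex^2^2" where
  "J11 = (\<chi> i j. if i = j then (if i = 1 then 1 else - 1) else 0)"

definition U11 :: "(complex^2^2) monoid" where
  "U11 = \<lparr>carrier = {A. mat_adj A ** J11 ** A = J11}, mult = (**), one = mat 1\<rparr>"

definition U11_scalars :: "(complex^2^2) set" where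
  "U11_scalars = {mat c | c. cmod c = 1}"

text \<open>\<open>PU(1,1) = U(1,1)/U(1)\<close> consists of the cosets of the group of scalar matrices and carries
  the quotient topology. The coset of \<open>A\<close> acts on the closed unit disc by \<open>moebius A\<close>.\<close>

definition PU11 :: "(complex^2^2) set monoid" where
  "PU11 = U11 Mod U11_scalars"

definition PU11_topology :: "(complex^2^2) set topology" where
  "PU11_topology =
     topology (\<lambda>V. V \<subseteq> carrier PU11 \<and> openin (top_of_set (carrier U11)) (\<Union>V))"

definition moebius :: "complex^2^2 \<Rightarrow> complex \<Rightarrow> complex" where
  "moebius A z = (A $ 1 $ 1 * z + A $ 1 $ 2) / (A $ 2 $ 1 * z + A $ 2 $ 2)"

lemma mat_adj_mult: "mat_adj (A ** B) = mat_adj B ** mat_adj A"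
  by (simp add: mat_adj_def matrix_matrix_mult_def vec_eq_iff mult.commute)

lemma mat_adj_mat: "mat_adj (mat c) = mat (cnj c)"
  by (simp add: mat_adj_def mat_def vec_eq_iff)

lemma mat_mult_commute: "mat c ** A = A ** mat (c::complex)" for A :: "complex^2^2"
  by (simp add: matrix_matrix_mult_def mat_def vec_eq_iff UNIV_2 forall_2)

lemma mat_mult_mat: "mat c ** mat d = (mat (c * d) :: complex^2^2)"
  by (simp add: matrix_matrix_mult_def mat_def vec_eq_iff UNIV_2 forall_2)

lemma J11_square: "J11 ** J11 = mat 1"
  by (simp add: matrix_matrix_mult_def J11_def mat_def vec_eq_iff UNIV_2 forall_2)

lemma mat_adj_J11: "mat_adj J11 = J11"
  by (simp add: mat_adj_def J11_def vec_eq_iff forall_2)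

lemma group_U11: "group U11"
proof (rule groupI)
  fix A B assume "A \<in> carrier U11" "B \<in> carrier U11"
  then have A: "mat_adj A ** J11 ** A = J11" and B: "mat_adj B ** J11 ** B = J11"
    by (auto simp: U11_def)
  have "mat_adj (A ** B) ** J11 ** (A ** B) = mat_adj B ** (mat_adj A ** J11 ** A) ** B"
    by (simp add: mat_adj_mult matrix_mul_assoc)
  with A B show "A \<otimes>\<^bsub>U11\<^esub> B \<in> carrier U11" by (simp add: U11_def)
next
  fix A assume "A \<in> carrier U11"
  then have A: "mat_adj A ** J11 ** A = J11" by (auto simp: U11_def)
  let ?B = "J11 ** mat_adj A ** J11"
  have BA: "?B ** A = mat 1"
    using A by (metis J11_square matrix_mul_assoc)
  then have AB: "A ** ?B = mat 1" by (simp add: matrix_left_right_inverse)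
  have "mat_adj ?B ** J11 ** ?B = mat_adj ?B ** (mat_adj A ** J11 ** A) ** ?B"
    using A by simp
  also have "\<dots> = mat_adj (A ** ?B) ** J11 ** (A ** ?B)"
    by (simp add: mat_adj_mult matrix_mul_assoc)
  also have "\<dots> = J11" using AB by (simp add: mat_adj_mat)
  finally show "\<exists>B\<in>carrier U11. B \<otimes>\<^bsub>U11\<^esub> A = \<one>\<^bsub>U11\<^esub>"
    using BA by (auto simp: U11_def)
qed (auto simp: U11_def matrix_mul_assoc mat_adj_mat)

lemma normal_U11_scalars: "U11_scalars \<lhd> U11"
proof -
  interpret group U11 by (rule group_U11)
  have sub: "U11_scalars \<subseteq> carrier U11"
  proof
    fix A assume "A \<in> U11_scalars"
    then obtain c where A: "A = mat c" "cmod c = 1" by (auto simp: U11_scalars_def)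
    have "mat_adj A ** J11 ** A = mat (cnj c * c) ** J11"
      by (simp add: A mat_adj_mat mat_mult_commute[of c, symmetric] matrix_mul_assoc mat_mult_mat
          mult.commute)
    also have "cnj c * c = 1"
      using A(2) by (metis complex_norm_square mult.commute of_real_1 one_power2)
    finally show "A \<in> carrier U11" by (simp add: U11_def)
  qed
  have inv: "inv\<^bsub>U11\<^esub> (mat c) = mat (inverse c)" if "cmod c = 1" for c
  proof (rule inv_equality)
    have "c \<noteq> 0" using that by auto
    then show "mat (inverse c) \<otimes>\<^bsub>U11\<^esub> mat c = \<one>\<^bsub>U11\<^esub>"
      by (simp add: U11_def mat_mult_mat)
  next
    have "cmod (inverse c) = 1" using that by (simp add: norm_inverse)
    then have "mat c \<in> U11_scalars" "mat (inverse c) \<in> U11_scalars"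
      using that by (auto simp: U11_scalars_def)
    with sub show "mat c \<in> carrier U11" "mat (inverse c) \<in> carrier U11" by auto
  qed
  have "subgroup U11_scalars U11"
  proof (rule subgroupI[OF sub])
    have "mat 1 \<in> U11_scalars" unfolding U11_scalars_def using norm_one by blast
    then show "U11_scalars \<noteq> {}" by blast
  next
    fix a assume "a \<in> U11_scalars"
    then show "inv\<^bsub>U11\<^esub> a \<in> U11_scalars"
      by (auto simp: U11_scalars_def inv) (metis inverse_1 norm_inverse)
  next
    fix a b assume "a \<in> U11_scalars" "b \<in> U11_scalars"
    then obtain c d where "a = mat c" "cmod c = 1" "b = mat d" "cmod d = 1"
      by (auto simp: U11_scalars_def)
    moreover have "cmod (c * d) = 1" using calculation by (simp add: norm_mult)
    ultimately show "a \<otimes>\<^bsub>U11\<^esub> b \<in> U11_scalars"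
      by (auto simp: U11_scalars_def U11_def mat_mult_mat)
  qed
  then show ?thesis
  proof (rule normalI, intro ballI)
    fix A
    have "c \<otimes>\<^bsub>U11\<^esub> A = A \<otimes>\<^bsub>U11\<^esub> c" if "c \<in> U11_scalars" for c
      using that by (auto simp: U11_def U11_scalars_def mat_mult_commute)
    then show "U11_scalars #>\<^bsub>U11\<^esub> A = A <#\<^bsub>U11\<^esub> U11_scalars"
      by (simp add: r_coset_def l_coset_def)
  qed
qed

lemma group_PU11: "group PU11"
  unfolding PU11_def by (rule normal.factorgroup_is_group[OF normal_U11_scalars])

lemma openin_PU11_topology:
  "openin PU11_topology V \<longleftrightarrow> V \<subseteq> carrier PU11 \<and> openin (top_of_set (carrier U11)) (\<Union>V)"
proof -
  interpret normal U11_scalars U11 by (rule normal_U11_scalars)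
  have Int: "\<Union>(V \<inter> W) = \<Union>V \<inter> \<Union>W" if "V \<subseteq> carrier PU11" "W \<subseteq> carrier PU11" for V W
  proof
    show "\<Union>V \<inter> \<Union>W \<subseteq> \<Union>(V \<inter> W)"
    proof
      fix x assume "x \<in> \<Union>V \<inter> \<Union>W"
      then obtain a b where ab: "a \<in> V" "b \<in> W" "x \<in> a" "x \<in> b" by blast
      with that have "a \<in> rcosets\<^bsub>U11\<^esub> U11_scalars" "b \<in> rcosets\<^bsub>U11\<^esub> U11_scalars"
        by (auto simp: PU11_def FactGroup_def)
      then have "a = b"
        using rcos_disjoint[OF subgroup_axioms] ab(3,4) unfolding pairwise_def disjnt_def by blast
      with ab show "x \<in> \<Union>(V \<inter> W)" by blast
    qed
  qed blast
  have "istopology (\<lambda>V. V \<subseteq> carrier PU11 \<and> openin (top_of_set (carrier U11)) (\<Union>V))"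
    unfolding istopology_def
  proof (intro conjI allI impI; (elim conjE)?)
    fix V W
    assume "V \<subseteq> carrier PU11" "W \<subseteq> carrier PU11"
      "openin (top_of_set (carrier U11)) (\<Union>V)" "openin (top_of_set (carrier U11)) (\<Union>W)"
    then show "openin (top_of_set (carrier U11)) (\<Union>(V \<inter> W))"
      using Int by (metis openin_Int)
  next
    fix K
    assume *: "\<forall>V\<in>K. V \<subseteq> carrier PU11 \<and> openin (top_of_set (carrier U11)) (\<Union>V)"
    then show "\<Union>K \<subseteq> carrier PU11" by blast
    have "\<Union>(\<Union>K) = (\<Union>V\<in>K. \<Union>V)" by blast
    moreover have "openin (top_of_set (carrier U11)) (\<Union>V\<in>K. \<Union>V)"
      using * by (intro openin_Union) auto
    ultimately show "openin (top_of_set (carrier U11)) (\<Union>(\<Union>K))" by simp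
  qed blast
  then show ?thesis by (simp add: PU11_topology_def topology_inverse')
qed

definition topological_group :: "('g, 'm) monoid_scheme \<Rightarrow> 'g topology \<Rightarrow> bool" where
  "topological_group G T \<longleftrightarrow>
     group G \<and> topspace T = carrier G \<and>
     continuous_map (prod_topology T T) T (\<lambda>(g, h). g \<otimes>\<^bsub>G\<^esub> h) \<and>
     continuous_map T T (\<lambda>g. inv\<^bsub>G\<^esub> g)"

text \<open>The following two notions are the counterparts for abstract topologies of
  \<^const>\<open>covering_space\<close> and \<^const>\<open>simply_connected\<close>. As there, simple connectedness includes
  path connectedness, since any two loops, in particular constant ones, are required to be
  freely homotopic.\<close>

definition covering_map :: "'a topology \<Rightarrow> 'b topology \<Rightarrow> ('a \<Rightarrow> 'b) \<Rightarrow> bool" where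
  "covering_map X Y p \<longleftrightarrow>
     continuous_map X Y p \<and> p ` topspace X = topspace Y \<and>
     (\<forall>y\<in>topspace Y. \<exists>V. openin Y V \<and> y \<in> V \<and>
        (\<exists>\<U>. \<Union>\<U> = {x \<in> topspace X. p x \<in> V} \<and> (\<forall>U\<in>\<U>. openin X U) \<and> pairwise disjnt \<U> \<and>
             (\<forall>U\<in>\<U>. homeomorphic_map (subtopology X U) (subtopology Y V) p)))"

definition simply_connected_space :: "'a topology \<Rightarrow> bool" where
  "simply_connected_space X \<longleftrightarrow>
     (\<forall>c d. pathin X c \<and> c 1 = c 0 \<and> pathin X d \<and> d 1 = d 0 \<longrightarrow>
        homotopic_with (\<lambda>r. r 1 = r 0) (top_of_set {0..1::real}) X c d)"

definition universal_covering_group ::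
  "('g, 'm) monoid_scheme \<Rightarrow> 'g topology \<Rightarrow> ('h, 'n) monoid_scheme \<Rightarrow> 'h topology \<Rightarrow> ('g \<Rightarrow> 'h) \<Rightarrow> bool"
  where
  "universal_covering_group G T G0 T0 p \<longleftrightarrow>
     topological_group G T \<and> simply_connected_space T \<and> p \<in> hom G G0 \<and> covering_map T T0 p"

text \<open>The circle \<open>\<real>/\<int>\<close> is identified with the unit circle via \<open>x \<mapsto> exp (2\<pi>ix)\<close>.\<close>

definition lifted_action ::
  "('g, 'm) monoid_scheme \<Rightarrow> 'g topology \<Rightarrow> ('g \<Rightarrow> (complex^2^2) set) \<Rightarrow> ('g \<Rightarrow> real \<Rightarrow> real) \<Rightarrow> bool"
  where
  "lifted_action G T p act \<longleftrightarrow>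
     (\<forall>x. act \<one>\<^bsub>G\<^esub> x = x) \<and>
     (\<forall>g\<in>carrier G. \<forall>h\<in>carrier G. \<forall>x. act (g \<otimes>\<^bsub>G\<^esub> h) x = act g (act h x)) \<and>
     continuous_map (prod_topology T euclideanreal) euclideanreal (\<lambda>(g, x). act g x) \<and>
     (\<forall>g\<in>carrier G. strict_mono (act g) \<and> (\<forall>x. act g (x + 1) = act g x + 1)) \<and>
     (\<forall>g\<in>carrier G. \<forall>A\<in>p g. \<forall>x. cis (2 * pi * act g x) = moebius A (cis (2 * pi * x)))"

definition geometric_order :: "('g, 'm) monoid_scheme \<Rightarrow> ('g \<Rightarrow> real \<Rightarrow> real) \<Rightarrow> ('g \<times> 'g) set" where
  "geometric_order G act =
     {(h, g). h \<in> carrier G \<and> g \<in> carrier G \<and> (\<forall>x. act g x \<ge> act h x)}"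

text \<open>The invariant relation with order semigroup \<open>S\<close>: by left invariance, \<open>h \<le> g\<close> iff
  \<open>h\<inverse>g \<ge> e\<close>.\<close>

definition order_of_semigroup :: "('g, 'm) monoid_scheme \<Rightarrow> 'g set \<Rightarrow> ('g \<times> 'g) set" where
  "order_of_semigroup G S =
     {(h, g). h \<in> carrier G \<and> g \<in> carrier G \<and> inv\<^bsub>G\<^esub> h \<otimes>\<^bsub>G\<^esub> g \<in> S}"

definition order_semigroup :: "('g, 'm) monoid_scheme \<Rightarrow> ('g \<times> 'g) set \<Rightarrow> 'g set" where
  "order_semigroup G R = {g \<in> carrier G. (\<one>\<^bsub>G\<^esub>, g) \<in> R}"

text \<open>The covering homomorphism identifies the Lie algebra of \<open>G\<close> with that of \<open>PU(1,1)\<close>, that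
  is, with \<open>\<uu>(1,1)/i\<real> = \<ss>\<uu>(1,1)\<close>. Under this identification \<open>Ad g\<close> is conjugation by any
  matrix representing \<open>p g\<close>, and \<open>t \<mapsto> exp (t X)\<close> in \<open>G\<close> is the one-parameter subgroup lifting
  the class of the matrix exponential of \<open>t X\<close>.\<close>

definition su11 :: "(complex^2^2) set" where
  "su11 = {X. mat_adj X ** J11 + J11 ** X = 0 \<and> trace X = 0}"

text \<open>The type class operations \<open>*\<close> and \<open>^\<close> on matrices would be componentwise.\<close>

definition mat_exp :: "complex^2^2 \<Rightarrow> complex^2^2" where
  "mat_exp X = (\<Sum>n. (1 / fact n) *\<^sub>R (((**) X ^^ n) (mat 1)))"

definition one_parameter_subgroup ::
  "('g, 'm) monoid_scheme \<Rightarrow> 'g topology \<Rightarrow> (real \<Rightarrow> 'g) \<Rightarrow> bool" where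
  "one_parameter_subgroup G T \<gamma> \<longleftrightarrow>
     continuous_map euclideanreal T \<gamma> \<and> (\<forall>s t. \<gamma> (s + t) = \<gamma> s \<otimes>\<^bsub>G\<^esub> \<gamma> t)"

definition lie_exp ::
  "('g, 'm) monoid_scheme \<Rightarrow> 'g topology \<Rightarrow> ('g \<Rightarrow> (complex^2^2) set) \<Rightarrow> complex^2^2 \<Rightarrow> 'g" where
  "lie_exp G T p X =
     (THE g. \<exists>\<gamma>. one_parameter_subgroup G T \<gamma> \<and>
        (\<forall>t. p (\<gamma> t) = U11_scalars #>\<^bsub>U11\<^esub> mat_exp (t *\<^sub>R X)) \<and> g = \<gamma> 1)"

definition Ad_invariant ::
  "('g, 'm) monoid_scheme \<Rightarrow> ('g \<Rightarrow> (complex^2^2) set) \<Rightarrow> (complex^2^2) set \<Rightarrow> bool" where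
  "Ad_invariant G p C \<longleftrightarrow>
     (\<forall>g\<in>carrier G. \<forall>A\<in>p g. \<forall>X\<in>C. A ** X ** matrix_inv A \<in> C)"

definition invariant_cone ::
  "('g, 'm) monoid_scheme \<Rightarrow> ('g \<Rightarrow> (complex^2^2) set) \<Rightarrow> (complex^2^2) set \<Rightarrow> bool" where
  "invariant_cone G p C \<longleftrightarrow>
     C \<subseteq> su11 \<and> cone C \<and> convex C \<and> closed C \<and> C \<inter> uminus ` C = {0} \<and> C \<noteq> {0} \<and>
     Ad_invariant G p C"

inductive_set generated_subsemigroup :: "('g, 'm) monoid_scheme \<Rightarrow> 'g set \<Rightarrow> 'g set"
  for G (structure) and S where
  base: "g \<in> S \<Longrightarrow> g \<in> generated_subsemigroup G S"
| mult: "g \<in> generated_subsemigroup G S \<Longrightarrow> h \<in> generated_subsemigroup G S \<Longrightarrow>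
         g \<otimes> h \<in> generated_subsemigroup G S"

definition lie_semigroup ::
  "('g, 'm) monoid_scheme \<Rightarrow> 'g topology \<Rightarrow> ('g \<Rightarrow> (complex^2^2) set) \<Rightarrow> (complex^2^2) set \<Rightarrow> 'g set"
  where
  "lie_semigroup G T p C = T closure_of (generated_subsemigroup G (lie_exp G T p ` C))"

definition lie_order ::
  "('g, 'm) monoid_scheme \<Rightarrow> 'g topology \<Rightarrow> ('g \<Rightarrow> (complex^2^2) set) \<Rightarrow> (complex^2^2) set \<Rightarrow>
   ('g \<times> 'g) set"
  where
  "lie_order G T p C = order_of_semigroup G (lie_semigroup G T p C)"

text \<open>The quantifier over \<open>x\<close> expresses that the limit does not depend on the base point.\<close>

definition translation_number ::
  "('g, 'm) monoid_scheme \<Rightarrow> ('g \<Rightarrow> real \<Rightarrow> real) \<Rightarrow> 'g \<Rightarrow> real" where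
  "translation_number G act g =
     (THE t. \<forall>x. (\<lambda>n. (act (g [^]\<^bsub>G\<^esub> (n::nat)) x - x) / real n) \<longlonglongrightarrow> t)"

definition maximal_semigroup ::
  "('g, 'm) monoid_scheme \<Rightarrow> ('g \<Rightarrow> real \<Rightarrow> real) \<Rightarrow> 'g set" where
  "maximal_semigroup G act =
     {g \<in> carrier G. \<forall>h\<in>carrier G.
        translation_number G act (h \<otimes>\<^bsub>G\<^esub> g) \<ge> translation_number G act h}"

definition maximal_order ::
  "('g, 'm) monoid_scheme \<Rightarrow> ('g \<Rightarrow> real \<Rightarrow> real) \<Rightarrow> ('g \<times> 'g) set" where
  "maximal_order G act = order_of_semigroup G (maximal_semigroup G act)"

definition conj_invariant_subsemigroup :: "('g, 'm) monoid_scheme \<Rightarrow> 'g set \<Rightarrow> bool" where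
  "conj_invariant_subsemigroup G S \<longleftrightarrow>
     S \<subseteq> carrier G \<and> (\<forall>g\<in>S. \<forall>h\<in>S. g \<otimes>\<^bsub>G\<^esub> h \<in> S) \<and>
     (\<forall>k\<in>carrier G. \<forall>g\<in>S. k \<otimes>\<^bsub>G\<^esub> g \<otimes>\<^bsub>G\<^esub> inv\<^bsub>G\<^esub> k \<in> S)"

definition maximal_conj_invariant_subsemigroup :: "('g, 'm) monoid_scheme \<Rightarrow> 'g set \<Rightarrow> bool" where
  "maximal_conj_invariant_subsemigroup G S \<longleftrightarrow>
     conj_invariant_subsemigroup G S \<and> S \<noteq> carrier G \<and>
     \<not> (\<exists>S'. conj_invariant_subsemigroup G S' \<and> S \<subset> S' \<and> S' \<subset> carrier G)"

end

theory Submission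
  imports Defs
begin

text \<open>Call \<open>g\<close> nonnegative if \<open>g.x \<ge> x\<close> for all \<open>x\<close>; these elements form the order semigroup of the
  geometric order, and the Lie semigroup and the maximal semigroup are both shown to equal it.

  Everything rests on the Iwasawa decomposition of \<open>G\<close> (\<open>iwasawa_decomposition\<close>): every \<open>g\<close> is the
  rotation \<open>x \<mapsto> x + g.0\<close> times a lifted boost times a lifted parabolic shear, the last two factors
  fixing \<open>0\<close>. In \<open>PU(1,1)\<close> this is a computation with matrices. It holds in \<open>G\<close> because the
  parameters depend continuously on \<open>g\<close>, so that the product of the three factors is a continuous
  lift of the covering homomorphism agreeing with the identity at the unit; as \<open>G\<close> is connected, the
  two lifts are equal. In particular an element of \<open>G\<close> is determined by its matrix class and its
  action on the line. The lifted factors themselves come from lifting one-parameter subgroups through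
  the covering (\<open>one_parameter_subgroup_lift\<close>).

  Lie semigroup: elements of \<open>exp(C)\<close> are nonnegative by assumption, and being nonnegative is a closed
  condition that products inherit. Conversely, if \<open>g\<close> is nonnegative with minimal displacement \<open>m\<close>,
  attained at \<open>a\<close>, then \<open>g\<close> followed by the rotation by \<open>-m\<close> is nonnegative and fixes \<open>a\<close>. A
  nonnegative element with a fixed point is conjugate by a rotation to a nonnegative shear: a nontrivial
  boost factor would move points in both directions. Hence \<open>g\<close> is a rotation times a conjugate of a
  shear (\<open>nonneg_element_factorization\<close>), and both factors lie in \<open>exp(C)\<close> because every invariant
  cone contains, up to sign, the generators of the rotations and of the shears.

  Maximal semigroup: composing with a nonnegative element raises all orbits, hence the translation
  number. If instead \<open>g.x < a < x\<close> for some \<open>a\<close>, a strong shear \<open>h\<close> fixing \<open>a\<close> pushes \<open>g.x\<close> below \<open>x - 1\<close>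
  (\<open>push_down\<close>), so \<open>T(hg) \<le> -1 < 0 = T(h)\<close>.

  Maximality: by the same shears, a conjugation-invariant semigroup containing the nonnegative elements
  and one further element contains some \<open>k\<close> that lowers a point by a full turn. The powers of \<open>k\<close> then lie
  below any \<open>f\<close>, and \<open>f\<close> is a power of \<open>k\<close> times a nonnegative element. The continuous function describing
  the semigroup is the translation number.\<close>

section \<open>Lifting through covering homomorphisms\<close>

locale top_group =
  fixes G :: "('g, 'm) monoid_scheme" (structure) and T :: "'g topology"
  assumes topological_group: "topological_group G T"

sublocale top_group \<subseteq> group G
  using topological_group by (simp add: topological_group_def)

context top_group
begin

lemma topspace_eq: "topspace T = carrier G"
  using topological_group by (simp add: topological_group_def)

lemma continuous_map_in_carrier:
  assumes "continuous_map Z T f" "z \<in> topspace Z"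
  shows "f z \<in> carrier G"
  using continuous_map_image_subset_topspace[OF assms(1)] assms(2) topspace_eq by blast

lemma continuous_map_mult:
  assumes "continuous_map Z T f" "continuous_map Z T f'"
  shows "continuous_map Z T (\<lambda>z. f z \<otimes> f' z)"
proof -
  have "continuous_map Z (prod_topology T T) (\<lambda>z. (f z, f' z))"
    using assms by (simp add: continuous_map_pairwise o_def)
  moreover have "continuous_map (prod_topology T T) T (\<lambda>(g, h). g \<otimes> h)"
    using topological_group by (simp add: topological_group_def)
  ultimately have "continuous_map Z T ((\<lambda>(g, h). g \<otimes> h) \<circ> (\<lambda>z. (f z, f' z)))"
    by (rule continuous_map_compose)
  then show ?thesis by (simp add: o_def)
qed

lemma continuous_map_inv:
  assumes "continuous_map Z T f"
  shows "continuous_map Z T (\<lambda>z. inv (f z))"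
proof -
  have "continuous_map T T (\<lambda>g. inv g)"
    using topological_group by (simp add: topological_group_def)
  then have "continuous_map Z T ((\<lambda>g. inv g) \<circ> f)"
    by (rule continuous_map_compose[OF assms])
  then show ?thesis by (simp add: o_def)
qed

lemma continuous_map_const_carrier: "g \<in> carrier G \<Longrightarrow> continuous_map Z T (\<lambda>_. g)"
  by (simp add: topspace_eq)

lemma continuous_map_nat_pow:
  assumes "continuous_map Z T f"
  shows "continuous_map Z T (\<lambda>z. f z [^] (n::nat))"
  by (induction n) (auto intro: continuous_map_mult assms simp: topspace_eq)

lemma one_parameter_subgroup_0:
  assumes "one_parameter_subgroup G T \<gamma>"
  shows "\<gamma> 0 = \<one>"
proof -
  have *: "\<gamma> 0 \<in> carrier G"
    using assms continuous_map_in_carrier by (fastforce simp: one_parameter_subgroup_def)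
  have "\<gamma> (0 + 0) = \<gamma> 0 \<otimes> \<gamma> 0"
    using assms unfolding one_parameter_subgroup_def by blast
  then show ?thesis by (metis * add_0 l_cancel_one)
qed

lemma one_parameter_subgroup_carrier:
  assumes "one_parameter_subgroup G T \<gamma>"
  shows "\<gamma> t \<in> carrier G"
  using assms continuous_map_in_carrier by (fastforce simp: one_parameter_subgroup_def)

lemma one_parameter_subgroup_inv:
  assumes "one_parameter_subgroup G T \<gamma>"
  shows "inv (\<gamma> t) = \<gamma> (- t)"
proof (rule inv_equality)
  have "\<gamma> (- t + t) = \<gamma> (- t) \<otimes> \<gamma> t"
    using assms unfolding one_parameter_subgroup_def by blast
  then show "\<gamma> (- t) \<otimes> \<gamma> t = \<one>" using one_parameter_subgroup_0[OF assms] by simp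
qed (use one_parameter_subgroup_carrier[OF assms] in auto)

end

locale covering_hom = top_group G T + G0: group G0
  for G :: "('g, 'm) monoid_scheme" (structure) and T :: "'g topology"
    and G0 :: "('h, 'n) monoid_scheme" and T0 :: "'h topology" +
  fixes p :: "'g \<Rightarrow> 'h"
  assumes p_hom: "p \<in> hom G G0" and covering: "covering_map T T0 p"
    and topspace_base: "topspace T0 = carrier G0"

sublocale covering_hom \<subseteq> group_hom G G0 p
  by unfold_locales (rule p_hom)

context covering_hom
begin

lemma sheet_at_one:
  obtains U V \<sigma> where "openin T U" "\<one> \<in> U" "openin T0 V" "\<one>\<^bsub>G0\<^esub> \<in> V"
    "continuous_map (subtopology T0 V) T \<sigma>"
    "\<And>g. g \<in> U \<Longrightarrow> \<sigma> (p g) = g" "\<And>v. v \<in> V \<Longrightarrow> p (\<sigma> v) = v"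
proof -
  have "\<one>\<^bsub>G0\<^esub> \<in> topspace T0" by (simp add: topspace_base)
  then obtain V \<U> where V: "openin T0 V" "\<one>\<^bsub>G0\<^esub> \<in> V"
    and \<U>: "\<Union>\<U> = {x \<in> topspace T. p x \<in> V}" "\<forall>U\<in>\<U>. openin T U"
      "\<forall>U\<in>\<U>. homeomorphic_map (subtopology T U) (subtopology T0 V) p"
    using covering unfolding covering_map_def by meson
  have "\<one> \<in> \<Union>\<U>" using V(2) by (simp add: \<U>(1) topspace_eq)
  then obtain U where U: "U \<in> \<U>" "\<one> \<in> U" by blast
  with \<U> obtain \<sigma> where \<sigma>: "homeomorphic_maps (subtopology T U) (subtopology T0 V) p \<sigma>"
    by (meson homeomorphic_map_maps)
  have oU: "openin T U" using \<U>(2) U(1) by blast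
  have tU: "topspace T \<inter> U = U" using openin_subset[OF oU] by auto
  have tV: "topspace T0 \<inter> V = V" using openin_subset[OF V(1)] by auto
  show ?thesis
  proof (rule that[OF oU U(2) V])
    show "continuous_map (subtopology T0 V) T \<sigma>"
      using \<sigma> by (simp add: homeomorphic_maps_def continuous_map_in_subtopology)
    show "\<sigma> (p g) = g" if "g \<in> U" for g
      using \<sigma> that by (simp add: homeomorphic_maps_def tU)
    show "p (\<sigma> v) = v" if "v \<in> V" for v
      using \<sigma> that by (simp add: homeomorphic_maps_def tV)
  qed
qed

text \<open>The kernel of a covering homomorphism is discrete, because the sheet through the unit
  meets it only there; hence a kernel-valued map is locally constant.\<close>

lemma kernel_valued_map_trivial:
  assumes conn: "connected_space Z" and w: "continuous_map Z T w"
    and ker: "\<And>z. z \<in> topspace Z \<Longrightarrow> p (w z) = \<one>\<^bsub>G0\<^esub>"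
    and z0: "z0 \<in> topspace Z" "w z0 = \<one>" and z: "z \<in> topspace Z"
  shows "w z = \<one>"
proof (rule ccontr)
  assume nz: "w z \<noteq> \<one>"
  obtain U V \<sigma> where U: "openin T U" "\<one> \<in> U" and \<sigma>: "\<And>g. g \<in> U \<Longrightarrow> \<sigma> (p g) = g"
    by (rule sheet_at_one) blast
  have U_ker: "g = \<one>" if "g \<in> U" "p g = \<one>\<^bsub>G0\<^esub>" for g
    using \<sigma>[OF that(1)] \<sigma>[OF U(2)] that(2) by simp
  have fibre: "openin Z {x \<in> topspace Z. w x = k}" if k: "k \<in> carrier G" "p k = \<one>\<^bsub>G0\<^esub>" for k
  proof -
    have "continuous_map Z T (\<lambda>x. inv k \<otimes> w x)"
      by (intro continuous_map_mult w continuous_map_const_carrier) (use k in auto)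
    from openin_continuous_map_preimage[OF this U(1)]
    have "openin Z {x \<in> topspace Z. inv k \<otimes> w x \<in> U}" .
    moreover have "inv k \<otimes> w x \<in> U \<longleftrightarrow> w x = k" if "x \<in> topspace Z" for x
    proof
      have wx: "w x \<in> carrier G" using w that by (rule continuous_map_in_carrier)
      assume "inv k \<otimes> w x \<in> U"
      moreover have "p (inv k \<otimes> w x) = \<one>\<^bsub>G0\<^esub>" using k wx ker[OF that] by simp
      ultimately have "inv k \<otimes> w x = \<one>" by (rule U_ker)
      then show "w x = k" using k wx by (simp add: inv_solve_left' inv_solve_left)
    qed (use k U in auto)
    ultimately show ?thesis by (simp cong: conj_cong)
  qed
  let ?E1 = "{x \<in> topspace Z. w x = \<one>}"
  let ?E2 = "\<Union>k\<in>{k \<in> carrier G. p k = \<one>\<^bsub>G0\<^esub> \<and> k \<noteq> \<one>}. {x \<in> topspace Z. w x = k}"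
  have "openin Z ?E1" by (rule fibre) auto
  moreover have "openin Z ?E2" by (intro openin_Union) (use fibre in auto)
  moreover have "topspace Z \<subseteq> ?E1 \<union> ?E2"
    using continuous_map_in_carrier[OF w] ker by auto
  moreover have "?E1 \<inter> ?E2 = {}" by auto
  moreover have "z0 \<in> ?E1" using z0 by simp
  moreover have "z \<in> ?E2" using z nz ker[OF z] continuous_map_in_carrier[OF w z] by auto
  ultimately show False using connected_spaceD[OF conn, of ?E1 ?E2] by blast
qed

lemma lift_unique:
  assumes conn: "connected_space Z" and f: "continuous_map Z T f" "continuous_map Z T f'"
    and eq: "\<And>z. z \<in> topspace Z \<Longrightarrow> p (f z) = p (f' z)"
    and z0: "z0 \<in> topspace Z" "f z0 = f' z0" and z: "z \<in> topspace Z"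
  shows "f z = f' z"
proof -
  note in_c = continuous_map_in_carrier[OF f(1)] continuous_map_in_carrier[OF f(2)]
  have "inv (f z) \<otimes> f' z = \<one>"
  proof (rule kernel_valued_map_trivial[OF conn _ _ z0(1) _ z])
    show "continuous_map Z T (\<lambda>z. inv (f z) \<otimes> f' z)"
      by (intro continuous_map_mult continuous_map_inv f)
    show "p (inv (f x) \<otimes> f' x) = \<one>\<^bsub>G0\<^esub>" if "x \<in> topspace Z" for x
      using that in_c[OF that] eq[OF that] by simp
    show "inv (f z0) \<otimes> f' z0 = \<one>" using z0 in_c[OF z0(1)] by simp
  qed
  then show ?thesis using in_c[OF z] by (simp add: inv_solve_left' inv_solve_left)
qed

lemma one_parameter_subgroup_unique:
  assumes "one_parameter_subgroup G T \<gamma>" "one_parameter_subgroup G T \<gamma>'" "\<And>t. p (\<gamma> t) = p (\<gamma>' t)"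
  shows "\<gamma> = \<gamma>'"
proof
  fix t
  show "\<gamma> t = \<gamma>' t"
  proof (rule lift_unique[of euclideanreal \<gamma> \<gamma>' 0])
    show "connected_space euclideanreal"
      by (metis connected_UNIV connectedin_iff_connected connectedin_topspace topspace_euclidean)
  qed (use assms in \<open>auto simp: one_parameter_subgroup_0 one_parameter_subgroup_def\<close>)
qed

text \<open>Near \<open>0\<close> the lift is \<open>c = \<sigma> \<circ> \<delta>\<close> for a local section \<open>\<sigma>\<close> of \<open>p\<close>. It is a local homomorphism
  by uniqueness of lifts on a square, and \<open>t \<mapsto> c (t / n) ^ n\<close>, which does not depend on
  a sufficiently large \<open>n\<close>, extends it to the whole line.\<close>

lemma one_parameter_subgroup_lift:
  fixes \<delta> :: "real \<Rightarrow> 'h"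
  assumes cont: "continuous_map euclideanreal T0 \<delta>"
    and add: "\<And>s t. \<delta> (s + t) = \<delta> s \<otimes>\<^bsub>G0\<^esub> \<delta> t"
  obtains \<gamma> where "one_parameter_subgroup G T \<gamma>" "\<And>t. p (\<gamma> t) = \<delta> t"
proof -
  have \<delta>_in: "\<delta> t \<in> carrier G0" for t
    using continuous_map_image_subset_topspace[OF cont] topspace_base by auto
  have \<delta>0: "\<delta> 0 = \<one>\<^bsub>G0\<^esub>" by (metis add add_0 G0.l_cancel_one \<delta>_in)
  obtain U V \<sigma> where U: "openin T U" "\<one> \<in> U" and V: "openin T0 V" "\<one>\<^bsub>G0\<^esub> \<in> V"
    and \<sigma>_cont: "continuous_map (subtopology T0 V) T \<sigma>"
    and \<sigma>p: "\<And>g. g \<in> U \<Longrightarrow> \<sigma> (p g) = g" and p\<sigma>: "\<And>v. v \<in> V \<Longrightarrow> p (\<sigma> v) = v"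
    by (rule sheet_at_one) blast
  have "open {t. \<delta> t \<in> V}"
    using openin_continuous_map_preimage[OF cont V(1)] by simp
  then obtain \<epsilon> where \<epsilon>: "\<epsilon> > 0" "\<And>t. \<bar>t\<bar> < \<epsilon> \<Longrightarrow> \<delta> t \<in> V"
    using V(2) \<delta>0 unfolding open_dist dist_real_def by (metis diff_zero mem_Collect_eq)
  define c where "c = (\<lambda>t. \<sigma> (\<delta> t))"
  have c0: "c 0 = \<one>" using \<sigma>p[OF U(2)] by (simp add: c_def \<delta>0)
  have pc: "p (c t) = \<delta> t" if "\<bar>t\<bar> < \<epsilon>" for t using \<epsilon>(2)[OF that] p\<sigma> by (simp add: c_def)
  have c_cont: "continuous_map Z T (\<lambda>z. c (f z))"
    if "continuous_map Z euclideanreal f" "\<And>z. z \<in> topspace Z \<Longrightarrow> \<bar>f z\<bar> < \<epsilon>" for Z :: "'z topology" and f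
  proof -
    have "continuous_map Z T0 (\<lambda>z. \<delta> (f z))"
      using continuous_map_compose[OF that(1) cont] by (simp add: o_def)
    then have "continuous_map Z (subtopology T0 V) (\<lambda>z. \<delta> (f z))"
      using that(2) \<epsilon>(2) by (simp add: continuous_map_in_subtopology image_subset_iff)
    from continuous_map_compose[OF this \<sigma>_cont] show ?thesis by (simp add: o_def c_def)
  qed
  define \<eta> where "\<eta> = \<epsilon> / 2"
  have \<eta>: "\<eta> > 0" using \<epsilon> by (simp add: \<eta>_def)
  have c_in: "c t \<in> carrier G" if "\<bar>t\<bar> < \<epsilon>" for t
  proof -
    have "\<delta> t \<in> topspace (subtopology T0 V)" using \<epsilon>(2)[OF that] openin_subset[OF V(1)] by auto
    then show ?thesis
      using continuous_map_in_carrier[OF \<sigma>_cont] by (simp add: c_def)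
  qed
  have small_\<epsilon>: "\<bar>t\<bar> < \<epsilon>" if "\<bar>t\<bar> < \<eta>" for t
    using that \<epsilon>(1) unfolding \<eta>_def by linarith
  have c_in': "c t \<in> carrier G" if "\<bar>t\<bar> < \<eta>" for t using c_in small_\<epsilon>[OF that] .
  have c_add: "c (s + t) = c s \<otimes> c t" if st: "\<bar>s\<bar> < \<eta>" "\<bar>t\<bar> < \<eta>" for s t
  proof -
    let ?S = "{- \<eta> <..< \<eta>} \<times> {- \<eta> <..< \<eta>}"
    have "c (fst (s, t) + snd (s, t)) = c (fst (s, t)) \<otimes> c (snd (s, t))"
    proof (rule lift_unique[of "top_of_set ?S" _ _ "(0, 0)"])
      show "connected_space (top_of_set ?S)"
        using connectedin_iff_connected[of ?S] unfolding connectedin_def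
        by (simp add: connected_Times)
      show "continuous_map (top_of_set ?S) T (\<lambda>z. c (fst z + snd z))"
        by (rule c_cont) (auto simp: \<eta>_def intro!: continuous_intros)
      show "continuous_map (top_of_set ?S) T (\<lambda>z. c (fst z) \<otimes> c (snd z))"
        by (rule continuous_map_mult; rule c_cont) (auto simp: \<eta>_def intro!: continuous_intros)
      fix z assume "z \<in> topspace (top_of_set ?S)"
      then have z: "\<bar>fst z\<bar> < \<eta>" "\<bar>snd z\<bar> < \<eta>" by auto
      then have "\<bar>fst z + snd z\<bar> < \<epsilon>" "\<bar>fst z\<bar> < \<epsilon>" "\<bar>snd z\<bar> < \<epsilon>" by (auto simp: \<eta>_def)
      then show "p (c (fst z + snd z)) = p (c (fst z) \<otimes> c (snd z))"
        using c_in by (simp add: pc add)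
    qed (use st \<eta> c0 in auto)
    then show ?thesis by simp
  qed
  have c_mult: "c (real n * t) = c t [^] n" if "\<bar>real n * t\<bar> < \<eta>" for n t
    using that
  proof (induction n)
    case (Suc n)
    have *: "\<bar>real (Suc n) * t\<bar> = real n * \<bar>t\<bar> + \<bar>t\<bar>"
      by (simp only: abs_mult of_nat_Suc) (simp add: algebra_simps)
    have "0 \<le> real n * \<bar>t\<bar>" by simp
    then have "real n * \<bar>t\<bar> < \<eta>" "\<bar>t\<bar> < \<eta>" using Suc.prems unfolding * by linarith+
    then have "\<bar>real n * t\<bar> < \<eta>" "\<bar>t\<bar> < \<eta>" by (auto simp: abs_mult)
    then have "c (real n * t + t) = c t [^] n \<otimes> c t" using Suc.IH c_add by simp
    then show ?case by (simp add: algebra_simps)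
  qed (simp add: c0)
  define \<gamma> where "\<gamma> = (\<lambda>t. let n = (SOME n::nat. n > 0 \<and> \<bar>t\<bar> < real n * \<eta>) in c (t / real n) [^] n)"
  have small: "\<bar>t / real n\<bar> < \<eta>" if "n > 0" "\<bar>t\<bar> < real n * \<eta>" for t n
    using that by (simp add: abs_divide divide_less_eq mult.commute)
  have indep: "c (t / real n) [^] n = c (t / real m) [^] m"
    if "n > 0" "\<bar>t\<bar> < real n * \<eta>" "m > 0" "\<bar>t\<bar> < real m * \<eta>" for t n m
  proof -
    have *: "c (t / real n) = c (t / real (n * m)) [^] m" if "n > 0" "m > 0" "\<bar>t\<bar> < real n * \<eta>" for n m
      using c_mult[of m "t / real (n * m)"] small[OF that(1,3)] that(2) by simp
    have **: "c (t / real (n * m)) \<in> carrier G"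
    proof (rule c_in', rule small)
      have "real n * \<eta> \<le> real (n * m) * \<eta>"
        using that(3) \<eta> by (intro mult_right_mono of_nat_mono) simp_all
      then show "\<bar>t\<bar> < real (n * m) * \<eta>" using that by linarith
    qed (use that in simp)
    have "c (t / real n) [^] n = c (t / real (n * m)) [^] (n * m)"
      using *[of n m] that ** by (simp add: nat_pow_pow mult.commute)
    also have "\<dots> = c (t / real m) [^] m"
      using *[of m n] that ** by (simp add: nat_pow_pow mult.commute)
    finally show ?thesis .
  qed
  have \<gamma>: "\<gamma> t = c (t / real n) [^] n" if "n > 0" "\<bar>t\<bar> < real n * \<eta>" for t n
  proof -
    define m where "m = (SOME n::nat. n > 0 \<and> \<bar>t\<bar> < real n * \<eta>)"
    have "\<exists>n::nat. n > 0 \<and> \<bar>t\<bar> < real n * \<eta>" using that by blast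
    then have "m > 0 \<and> \<bar>t\<bar> < real m * \<eta>" unfolding m_def by (rule someI_ex)
    moreover have "\<gamma> t = c (t / real m) [^] m" by (simp add: \<gamma>_def Let_def m_def)
    ultimately show ?thesis using indep[of m t n] that by metis
  qed
  have large: "\<exists>n::nat. n > 0 \<and> r < real n * \<eta>" for r
  proof -
    obtain n :: nat where "r / \<eta> < real n" using reals_Archimedean2 by blast
    then have "r < real n * \<eta>" using \<eta> by (simp add: divide_less_eq)
    then have "r < real (Suc n) * \<eta>" using \<eta> by (simp add: algebra_simps)
    then show ?thesis by blast
  qed
  show thesis
  proof (rule that[of \<gamma>])
    have \<gamma>_add: "\<gamma> (s + t) = \<gamma> s \<otimes> \<gamma> t" for s t
    proof -
      obtain n :: nat where n: "n > 0" "\<bar>s\<bar> + \<bar>t\<bar> < real n * \<eta>" using large by blast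
      then have b: "\<bar>s\<bar> < real n * \<eta>" "\<bar>t\<bar> < real n * \<eta>" "\<bar>s + t\<bar> < real n * \<eta>" by linarith+
      note sm = small[OF n(1) b(1)] small[OF n(1) b(2)]
      have "\<gamma> (s + t) = (c (s / real n) \<otimes> c (t / real n)) [^] n"
        using \<gamma>[OF n(1) b(3)] c_add[OF sm] by (simp add: add_divide_distrib)
      also have "\<dots> = c (s / real n) [^] n \<otimes> c (t / real n) [^] n"
      proof (rule pow_mult_distrib)
        show "c (s / real n) \<otimes> c (t / real n) = c (t / real n) \<otimes> c (s / real n)"
          using c_add[OF sm] c_add[OF sm(2,1)] by (simp add: add.commute)
      qed (use sm c_in' in auto)
      finally show ?thesis using \<gamma>[OF n(1)] b by simp
    qed
    have "continuous_map euclideanreal T \<gamma>"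
    proof (rule pasting_lemma[where I = "{n::nat. n > 0}" and T = "\<lambda>n. {t. \<bar>t\<bar> < real n * \<eta>}"
          and f = "\<lambda>n t. c (t / real n) [^] n"])
      fix n :: nat assume "n \<in> {n. n > 0}"
      then have n: "n > 0" by simp
      show "openin euclideanreal {t. \<bar>t\<bar> < real n * \<eta>}"
        by (simp add: open_Collect_less continuous_intros)
      show "continuous_map (top_of_set {t. \<bar>t\<bar> < real n * \<eta>}) T (\<lambda>t. c (t / real n) [^] n)"
      proof (rule continuous_map_nat_pow, rule c_cont)
        show "\<bar>z / real n\<bar> < \<epsilon>" if "z \<in> topspace (top_of_set {t. \<bar>t\<bar> < real n * \<eta>})" for z
          using small_\<epsilon>[OF small[OF n]] that by simp
      qed (use n in \<open>auto intro!: continuous_intros\<close>)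
    next
      show "\<exists>n. n \<in> {n. n > 0} \<and> t \<in> {t. \<bar>t\<bar> < real n * \<eta>} \<and> \<gamma> t = c (t / real n) [^] n" for t
        using large[of "\<bar>t\<bar>"] \<gamma> by auto
    qed (metis indep IntE mem_Collect_eq)
    with \<gamma>_add show "one_parameter_subgroup G T \<gamma>" by (simp add: one_parameter_subgroup_def)
    have \<delta>_pow: "\<delta> t [^]\<^bsub>G0\<^esub> n = \<delta> (real n * t)" for t and n :: nat
      by (induction n) (auto simp: \<delta>0 distrib_right add[symmetric] add.commute)
    show "p (\<gamma> t) = \<delta> t" for t
    proof -
      obtain n :: nat where n: "n > 0" "\<bar>t\<bar> < real n * \<eta>" using large by blast
      have sm: "\<bar>t / real n\<bar> < \<eta>" using small[OF n] .
      have "p (\<gamma> t) = p (c (t / real n)) [^]\<^bsub>G0\<^esub> n"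
        using \<gamma>[OF n] c_in'[OF sm] by (simp add: hom_nat_pow)
      also have "\<dots> = \<delta> (t / real n) [^]\<^bsub>G0\<^esub> n" 
        using pc[OF small_\<epsilon>[OF sm]] by simp
      also have "\<dots> = \<delta> t" using n by (simp add: \<delta>_pow)
      finally show ?thesis .
    qed
  qed
qed

end

section \<open>One-parameter subgroups of \<open>PU(1,1)\<close>\<close>

definition mat22 :: "complex \<Rightarrow> complex \<Rightarrow> complex \<Rightarrow> complex \<Rightarrow> complex^2^2" where
  "mat22 a b c d = (\<chi> i j. if i = 1 then (if j = 1 then a else b) else (if j = 1 then c else d))"

lemma mat22_nth [simp]:
  "mat22 a b c d $ 1 $ 1 = a" "mat22 a b c d $ 1 $ 2 = b"
  "mat22 a b c d $ 2 $ 1 = c" "mat22 a b c d $ 2 $ 2 = d"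
  by (simp_all add: mat22_def)

lemma mat22_eta: "mat22 (A $ 1 $ 1) (A $ 1 $ 2) (A $ 2 $ 1) (A $ 2 $ 2) = A"
  by (simp add: mat22_def vec_eq_iff forall_2)

lemma mat22_eq_iff: "mat22 a b c d = mat22 a' b' c' d' \<longleftrightarrow> a = a' \<and> b = b' \<and> c = c' \<and> d = d'"
  by (auto simp: mat22_def vec_eq_iff forall_2)

lemma mat22_mult:
  "mat22 a b c d ** mat22 a' b' c' d' =
     mat22 (a * a' + b * c') (a * b' + b * d') (c * a' + d * c') (c * b' + d * d')"
  by (simp add: matrix_matrix_mult_def vec_eq_iff forall_2 sum_2)

lemma mat22_add: "mat22 a b c d + mat22 a' b' c' d' = mat22 (a + a') (b + b') (c + c') (d + d')"
  by (simp add: vec_eq_iff forall_2)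

lemma mat22_uminus: "- mat22 a b c d = mat22 (- a) (- b) (- c) (- d)"
  by (simp add: vec_eq_iff forall_2)

lemma mat22_scaleR: "r *\<^sub>R mat22 a b c d = mat22 (r *\<^sub>R a) (r *\<^sub>R b) (r *\<^sub>R c) (r *\<^sub>R d)"
  by (simp add: vec_eq_iff forall_2)

lemma mat_eq_mat22: "mat c = mat22 c 0 0 c"
  by (simp add: mat_def vec_eq_iff forall_2)

lemma mat22_0: "mat22 0 0 0 0 = 0"
  by (simp add: vec_eq_iff forall_2)

lemma scaleR_mult_mat: "(r *\<^sub>R A) ** B = r *\<^sub>R (A ** B)" for A B :: "complex^2^2"
  by (simp add: matrix_matrix_mult_def vec_eq_iff scaleR_add_right sum_2)

lemma mult_scaleR_mat: "A ** (r *\<^sub>R B) = r *\<^sub>R (A ** B)" for A B :: "complex^2^2"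
  by (simp add: matrix_matrix_mult_def vec_eq_iff scaleR_add_right sum_2)

lemma add_mult_mat: "(A + B) ** C = A ** C + B ** C" for A B C :: "complex^2^2"
  by (simp add: matrix_matrix_mult_def vec_eq_iff sum_2 distrib_right)

lemma J11_eq_mat22: "J11 = mat22 1 0 0 (- 1)"
  by (simp add: J11_def vec_eq_iff forall_2)

lemma mat_adj_mat22: "mat_adj (mat22 a b c d) = mat22 (cnj a) (cnj c) (cnj b) (cnj d)"
  by (simp add: mat_adj_def vec_eq_iff forall_2)

lemma carrier_U11_mat22:
  "mat22 a b c d \<in> carrier U11 \<longleftrightarrow>
     cnj a * a - cnj c * c = 1 \<and> cnj a * b = cnj c * d \<and> cnj b * a = cnj d * c \<and>
     cnj b * b - cnj d * d = - 1"
  by (simp add: U11_def J11_eq_mat22 mat_adj_mat22 mat22_mult mat22_eq_iff)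

lemma continuous_on_mat22:
  fixes a b c d :: "'a::topological_space \<Rightarrow> complex"
  assumes "continuous_on S a" "continuous_on S b" "continuous_on S c" "continuous_on S d"
  shows "continuous_on S (\<lambda>x. mat22 (a x) (b x) (c x) (d x))"
  unfolding mat22_def
proof (intro continuous_on_vec_lambda)
  show "continuous_on S (\<lambda>x. if i = 1 then if j = 1 then a x else b x else if j = 1 then c x else d x)"
    for i j :: 2
    using assms exhaust_2[of i] exhaust_2[of j] by auto
qed

text \<open>The rotations, the hyperbolic boosts fixing \<open>1\<close> and the parabolic shears fixing \<open>1\<close> are the
  factors of the Iwasawa decomposition. The factor \<open>\<pi>\<close> makes \<open>rot t\<close> act on \<open>\<real>/\<int>\<close> as \<open>x \<mapsto> x + t\<close>.\<close>

definition rot :: "real \<Rightarrow> complex^2^2" where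
  "rot t = mat22 (cis (pi * t)) 0 0 (cis (- (pi * t)))"

definition boost :: "real \<Rightarrow> complex^2^2" where
  "boost s = mat22 (of_real (cosh s)) (of_real (sinh s)) (of_real (sinh s)) (of_real (cosh s))"

definition shear :: "real \<Rightarrow> complex^2^2" where
  "shear u = mat22 (1 + \<i> * u) (- \<i> * u) (\<i> * u) (1 - \<i> * u)"

lemma moebius_rot: "moebius (rot t) z = cis (pi * t) * z / cis (- (pi * t))"
  by (simp add: moebius_def rot_def)

lemma moebius_boost_1: "moebius (boost s) 1 = 1"
proof -
  have "complex_of_real (cosh s) + complex_of_real (sinh s) = complex_of_real (exp s)"
    by (metis cosh_plus_sinh of_real_add)
  then show ?thesis by (simp add: moebius_def boost_def add.commute)
qed

lemma moebius_shear_1: "moebius (shear u) 1 = 1"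
  by (simp add: moebius_def shear_def)

lemma rot_add: "rot (s + t) = rot s ** rot t"
  by (simp add: rot_def mat22_mult mat22_eq_iff cis_mult algebra_simps)

lemma boost_add: "boost (s + t) = boost s ** boost t"
  by (simp add: boost_def mat22_mult mat22_eq_iff cosh_add sinh_add algebra_simps)

lemma shear_add: "shear (s + t) = shear s ** shear t"
  by (simp add: shear_def mat22_mult mat22_eq_iff algebra_simps)

lemma cosh_sinh_diff: "complex_of_real (cosh s) * of_real (cosh s) - of_real (sinh s) * of_real (sinh s) = 1"
proof -
  have "cosh s * cosh s - sinh s * sinh s = 1"
    using cosh_square_eq[of s] by (simp add: power2_eq_square)
  then show ?thesis by (metis of_real_1 of_real_diff of_real_mult)
qed

lemma rot_in_U11: "rot t \<in> carrier U11"
  by (simp add: rot_def carrier_U11_mat22 cis_cnj cis_mult)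

lemma boost_in_U11: "boost t \<in> carrier U11"
  using cosh_sinh_diff[of t] by (simp add: boost_def carrier_U11_mat22 algebra_simps)

lemma shear_in_U11: "shear t \<in> carrier U11"
  by (simp add: shear_def carrier_U11_mat22 algebra_simps)

lemma continuous_on_rot: "continuous_on UNIV rot"
  unfolding rot_def by (intro continuous_on_mat22 continuous_intros)

lemma continuous_on_boost: "continuous_on UNIV boost"
  unfolding boost_def by (intro continuous_on_mat22 continuous_intros)

lemma continuous_on_shear: "continuous_on UNIV shear"
  unfolding shear_def by (intro continuous_on_mat22 continuous_intros)

abbreviation coset :: "complex^2^2 \<Rightarrow> (complex^2^2) set" where
  "coset A \<equiv> U11_scalars #>\<^bsub>U11\<^esub> A"

interpretation U11: group U11 by (rule group_U11)
interpretation PU11: group PU11 by (rule group_PU11)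
interpretation scalars: normal U11_scalars U11 by (rule normal_U11_scalars)

lemma mult_U11 [simp]: "A \<otimes>\<^bsub>U11\<^esub> B = A ** B"
  by (simp add: U11_def)

lemma one_U11 [simp]: "\<one>\<^bsub>U11\<^esub> = mat 1"
  by (simp add: U11_def)

lemma coset_hom: "coset \<in> hom U11 PU11"
  unfolding PU11_def by (rule scalars.r_coset_hom_Mod)

lemma coset_in_PU11: "A \<in> carrier U11 \<Longrightarrow> coset A \<in> carrier PU11"
  using coset_hom by (auto simp: hom_def)

lemma coset_mult: "A \<in> carrier U11 \<Longrightarrow> B \<in> carrier U11 \<Longrightarrow> coset (A ** B) = coset A \<otimes>\<^bsub>PU11\<^esub> coset B"
  using coset_hom by (auto simp: hom_def)

lemma coset_one: "coset (mat 1) = \<one>\<^bsub>PU11\<^esub>"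
  using hom_one[OF coset_hom group_U11 group_PU11] by simp

lemma mem_coset_self: "A \<in> carrier U11 \<Longrightarrow> A \<in> coset A"
  using U11.rcos_self scalars.subgroup_axioms by blast

lemma carrier_PU11E:
  assumes "a \<in> carrier PU11"
  obtains A where "A \<in> carrier U11" "a = coset A"
proof -
  have "\<exists>A\<in>carrier U11. a = coset A" using assms by (simp add: PU11_def FactGroup_def RCOSETS_def)
  then obtain A where "A \<in> carrier U11" "a = coset A" ..
  then show thesis by (rule that)
qed

lemma mem_PU11:
  assumes "a \<in> carrier PU11" "A \<in> a"
  shows "A \<in> carrier U11" "a = coset A"
proof -
  obtain B where B: "B \<in> carrier U11" "a = coset B" using assms(1) by (rule carrier_PU11E)
  have "coset B \<subseteq> carrier U11" using U11.r_coset_subset_G scalars.subset B by blast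
  with assms(2) B show "A \<in> carrier U11" by blast
  have "A \<in> coset B" using assms B by simp
  then show "a = coset A" using U11.repr_independence scalars.subgroup_axioms B by metis
qed

lemma coset_eq_scalar_multiple:
  assumes "A \<in> carrier U11" "coset A = coset B" "B \<in> carrier U11"
  obtains c where "cmod c = 1" "B = mat c ** A"
proof -
  have "B \<in> coset A" using mem_coset_self assms by metis
  then show ?thesis using that by (auto simp: r_coset_def U11_scalars_def)
qed

lemma coset_scalar_mult:
  assumes "A \<in> carrier U11" "cmod c = 1"
  shows "coset (mat c ** A) = coset A"
proof -
  have "mat c ** A \<in> coset A" using assms by (auto simp: r_coset_def U11_scalars_def)
  from U11.repr_independence[OF this assms(1) scalars.subgroup_axioms] show ?thesis ..
qed

lemma topspace_PU11: "topspace PU11_topology = carrier PU11"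
proof -
  have "\<Union>(carrier PU11) = carrier U11"
    using mem_PU11(1) mem_coset_self coset_in_PU11 by blast
  then have "openin PU11_topology (carrier PU11)" by (simp add: openin_PU11_topology)
  then show ?thesis
    by (meson openin_PU11_topology openin_subset openin_topspace subset_antisym)
qed

text \<open>For a set of cosets, the preimage under the projection is the union, which is what the quotient
  topology is defined by.\<close>

lemma coset_preimage_Union:
  assumes "V \<subseteq> carrier PU11"
  shows "{A \<in> carrier U11. coset A \<in> V} = \<Union>V"
  using assms mem_PU11 mem_coset_self by blast

lemma continuous_map_coset: "continuous_map (top_of_set (carrier U11)) PU11_topology coset"
  unfolding continuous_map_def
proof (intro conjI allI impI)
  fix V assume "openin PU11_topology V"
  then show "openin (top_of_set (carrier U11)) {A \<in> topspace (top_of_set (carrier U11)). coset A \<in> V}"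
    using coset_preimage_Union by (simp add: openin_PU11_topology)
qed (auto simp: topspace_PU11 coset_in_PU11)

lemma continuous_map_from_PU11:
  fixes f :: "complex^2^2 \<Rightarrow> 'a::topological_space"
  assumes f: "continuous_on (carrier U11) f"
    and F: "\<And>A. A \<in> carrier U11 \<Longrightarrow> F (coset A) = f A"
  shows "continuous_map PU11_topology euclidean F"
  unfolding continuous_map_def
proof (intro conjI allI impI)
  fix V :: "'a set" assume V: "openin euclidean V"
  let ?W = "{a \<in> topspace PU11_topology. F a \<in> V}"
  have sub: "?W \<subseteq> carrier PU11" by (auto simp: topspace_PU11)
  have "\<Union>?W = {A \<in> carrier U11. coset A \<in> ?W}" using coset_preimage_Union[OF sub] by simp
  also have "\<dots> = {A \<in> carrier U11. f A \<in> V}" by (auto simp: topspace_PU11 coset_in_PU11 F)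
  also have "openin (top_of_set (carrier U11)) \<dots>"
    using continuous_openin_preimage_gen[OF f, of V] V
    by (simp add: Collect_conj_eq vimage_def)
  finally show "openin PU11_topology ?W" using sub by (simp add: openin_PU11_topology)
qed auto

lemma continuous_map_coset_comp:
  assumes "continuous_on UNIV M" "\<And>t. M t \<in> carrier U11"
  shows "continuous_map euclideanreal PU11_topology (\<lambda>t. coset (M t))"
proof -
  have "continuous_map euclideanreal (top_of_set (carrier U11)) M"
    using assms by (auto simp: continuous_map_in_subtopology)
  from continuous_map_compose[OF this continuous_map_coset] show ?thesis by (simp add: o_def)
qed

section \<open>Exponentials in \<open>su(1,1)\<close>\<close>

lemma mat_exp_square_zero:
  assumes "X ** X = 0"
  shows "mat_exp X = mat 1 + X"
proof -
  have pow: "((**) X ^^ n) (mat 1) = (if n = 0 then mat 1 else if n = 1 then X else 0)" for n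
  proof (cases n)
    case (Suc m)
    show ?thesis unfolding Suc
    proof (induction m)
      case (Suc m)
      then show ?case by (cases m) (auto simp: assms)
    qed simp
  qed simp
  have "(\<Sum>n. (1 / fact n) *\<^sub>R (((**) X ^^ n) (mat 1))) =
        (\<Sum>n\<in>{0, 1}. (1 / fact n) *\<^sub>R (((**) X ^^ n) (mat 1)))"
    by (rule suminf_finite) (auto simp: pow)
  then show ?thesis by (simp add: mat_exp_def)
qed

lemma mat_exp_diag:
  "mat_exp (mat22 a 0 0 d) = mat22 (exp a) 0 0 (exp d)"
proof -
  have pow: "((**) (mat22 a 0 0 d) ^^ n) (mat 1) = mat22 (a ^ n) 0 0 (d ^ n)" for n
    by (induction n) (auto simp: mat_eq_mat22 mat22_mult)
  have partial: "(\<Sum>n<N. (1 / fact n) *\<^sub>R (((**) (mat22 a 0 0 d) ^^ n) (mat 1))) =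
      mat22 (\<Sum>n<N. a ^ n /\<^sub>R fact n) 0 0 (\<Sum>n<N. d ^ n /\<^sub>R fact n)" for N
    by (induction N) (auto simp: pow mat22_add mat22_scaleR mat22_0 divide_inverse)
  have "(\<lambda>N. mat22 (\<Sum>n<N. a ^ n /\<^sub>R fact n) 0 0 (\<Sum>n<N. d ^ n /\<^sub>R fact n))
      \<longlonglongrightarrow> mat22 (exp a) 0 0 (exp d)"
  proof (rule vec_tendstoI, rule vec_tendstoI)
    fix i j :: 2
    show "(\<lambda>N. mat22 (\<Sum>n<N. a ^ n /\<^sub>R fact n) 0 0 (\<Sum>n<N. d ^ n /\<^sub>R fact n) $ i $ j)
      \<longlonglongrightarrow> mat22 (exp a) 0 0 (exp d) $ i $ j"
      using exp_converges[of a] exp_converges[of d] exhaust_2[of i] exhaust_2[of j]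
      by (auto simp: sums_def)
  qed
  then have "(\<lambda>n. (1 / fact n) *\<^sub>R (((**) (mat22 a 0 0 d) ^^ n) (mat 1))) sums mat22 (exp a) 0 0 (exp d)"
    unfolding sums_def partial .
  then show ?thesis by (simp add: mat_exp_def sums_iff)
qed

definition rot_gen :: "complex^2^2" where
  "rot_gen = mat22 (\<i> * pi) 0 0 (- (\<i> * pi))"

definition shear_gen :: "complex^2^2" where
  "shear_gen = mat22 \<i> (- \<i>) \<i> (- \<i>)"

lemma mat_exp_rot_gen: "mat_exp (t *\<^sub>R rot_gen) = rot t"
  unfolding rot_gen_def mat22_scaleR
  by (simp add: mat_exp_diag rot_def mat22_eq_iff cis_conv_exp scaleR_conv_of_real mult_ac)

text \<open>A conjugate of the generator of the shears still squares to zero, so its exponential needs no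
  series.\<close>

lemma mat_exp_conj_shear_gen:
  assumes "A ** B = mat 1"
  shows "mat_exp (t *\<^sub>R (B ** (u *\<^sub>R shear_gen) ** A)) = B ** shear (t * u) ** A"
proof -
  have BA: "B ** A = mat 1" using assms by (simp add: matrix_left_right_inverse)
  have 0: "shear_gen ** shear_gen = 0"
    by (simp add: shear_gen_def mat22_mult mat22_0)
  let ?X = "t *\<^sub>R (B ** (u *\<^sub>R shear_gen) ** A)"
  have X: "?X = (t * u) *\<^sub>R (B ** shear_gen ** A)"
    by (simp add: scaleR_mult_mat mult_scaleR_mat)
  have "(B ** shear_gen ** A) ** (B ** shear_gen ** A) = B ** (shear_gen ** (A ** B) ** shear_gen) ** A"
    by (simp add: matrix_mul_assoc)
  then have "?X ** ?X = 0"
    unfolding X by (simp add: assms 0 scaleR_mult_mat mult_scaleR_mat)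
  then have "mat_exp ?X = B ** A + ?X" by (simp add: mat_exp_square_zero BA)
  also have "\<dots> = B ** (mat 1 + (t * u) *\<^sub>R shear_gen) ** A"
    unfolding X by (simp add: matrix_add_ldistrib add_mult_mat scaleR_mult_mat mult_scaleR_mat)
  also have "mat 1 + (t * u) *\<^sub>R shear_gen = shear (t * u)"
    unfolding shear_gen_def mat_eq_mat22 mat22_scaleR mat22_add shear_def
    by (simp add: mat22_eq_iff scaleR_conv_of_real)
  finally show ?thesis .
qed

section \<open>Lifted actions and the translation number\<close>

text \<open>Comparing both \<open>n a(m)\<close> and \<open>m a(n)\<close> with \<open>a(mn)\<close> bounds their distance by \<open>m + n\<close>, so the quotients
  \<open>a(n)/n\<close> form a Cauchy sequence; letting the second index go to infinity gives the rate \<open>1/n\<close>.\<close>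

lemma quasi_additive_limit:
  fixes a :: "nat \<Rightarrow> real"
  assumes quasi: "\<And>m n. \<bar>a (m + n) - a m - a n\<bar> \<le> 1"
  obtains t where "\<And>n. n > 0 \<Longrightarrow> \<bar>a n / real n - t\<bar> \<le> 1 / real n"
    "(\<lambda>n. a n / real n) \<longlonglongrightarrow> t"
proof -
  have a0: "\<bar>a 0\<bar> \<le> 1" using quasi[of 0 0] by simp
  have mult: "\<bar>a (Suc k * m) - real (Suc k) * a m\<bar> \<le> real k" for k m
  proof (induction k)
    case (Suc k)
    have "\<bar>a (m + Suc k * m) - a m - a (Suc k * m)\<bar> \<le> 1" by (rule quasi)
    with Suc have "\<bar>a (m + Suc k * m) - (a m + real (Suc k) * a m)\<bar> \<le> real k + 1" by linarith
    then show ?case by (simp add: algebra_simps)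
  qed simp
  have mult': "\<bar>a (k * m) - real k * a m\<bar> \<le> real k" if "k > 0" for k m
    using mult[of "k - 1" m] that by simp
  have close: "\<bar>a m / real m - a n / real n\<bar> \<le> 1 / real m + 1 / real n" if mn: "m > 0" "n > 0" for m n
  proof -
    have "\<bar>a (n * m) - real n * a m\<bar> \<le> real n" "\<bar>a (n * m) - real m * a n\<bar> \<le> real m"
      using mult'[of n m] mult'[of m n] mn by (simp_all add: mult.commute)
    then have "\<bar>real n * a m - real m * a n\<bar> \<le> real n + real m" by linarith
    then have "\<bar>real n * a m - real m * a n\<bar> / (real m * real n) \<le> (real n + real m) / (real m * real n)"
      by (intro divide_right_mono) auto
    also have "(real n + real m) / (real m * real n) = 1 / real m + 1 / real n"
      using mn by (simp add: field_simps)
    also have "\<bar>real n * a m - real m * a n\<bar> / (real m * real n) = \<bar>a m / real m - a n / real n\<bar>"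
      using mn by (simp add: abs_divide[symmetric] field_simps)
    finally show ?thesis .
  qed
  have "Cauchy (\<lambda>n. a n / real n)"
    unfolding Cauchy_def dist_real_def
  proof (intro allI impI)
    fix e :: real assume e: "e > 0"
    obtain N :: nat where N: "2 / e < real N" using reals_Archimedean2 by blast
    with e have N0: "N > 0" by (metis divide_pos_pos gr0I not_less_iff_gr_or_eq of_nat_0 zero_less_numeral order.strict_trans)
    have small: "1 / real m < e / 2" if "m \<ge> N" for m
    proof -
      have "2 / e < real m" "real m > 0" using N N0 that by linarith+
      then show ?thesis using e by (simp add: field_simps)
    qed
    show "\<exists>N. \<forall>m\<ge>N. \<forall>n\<ge>N. \<bar>a m / real m - a n / real n\<bar> < e"
    proof (intro exI[of _ N] allI impI)
      fix m n assume "m \<ge> N" "n \<ge> N"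
      then show "\<bar>a m / real m - a n / real n\<bar> < e"
        using close[of m n] small[of m] small[of n] N0 by linarith
    qed
  qed
  then obtain t where t: "(\<lambda>n. a n / real n) \<longlonglongrightarrow> t"
    using Cauchy_convergent convergent_def by blast
  show thesis
  proof (rule that[OF _ t])
    fix n :: nat assume n: "n > 0"
    have "(\<lambda>m. \<bar>a n / real n - a m / real m\<bar>) \<longlonglongrightarrow> \<bar>a n / real n - t\<bar>"
      by (intro tendsto_intros t)
    moreover have "(\<lambda>m. 1 / real n + 1 / real m) \<longlonglongrightarrow> 1 / real n + 0"
      by (intro tendsto_intros lim_1_over_n)
    ultimately show "\<bar>a n / real n - t\<bar> \<le> 1 / real n"
      using n close[of n] by (intro LIMSEQ_le[of _ _ "\<lambda>m. 1 / real n + 1 / real m"]) (auto intro!: exI[of _ 1])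
  qed
qed

locale pu11_cover =
  fixes G :: "('g, 'm) monoid_scheme" (structure) and T :: "'g topology"
    and p :: "'g \<Rightarrow> (complex^2^2) set" and act :: "'g \<Rightarrow> real \<Rightarrow> real"
  assumes cover: "universal_covering_group G T PU11 PU11_topology p"
    and action: "lifted_action G T p act"

sublocale pu11_cover \<subseteq> covering_hom G T PU11 PU11_topology p
  using cover
  by unfold_locales (auto simp: universal_covering_group_def topspace_PU11)

context pu11_cover
begin

lemma act_one [simp]: "act \<one> x = x"
  using action by (simp add: lifted_action_def)

lemma act_mult: "g \<in> carrier G \<Longrightarrow> h \<in> carrier G \<Longrightarrow> act (g \<otimes> h) x = act g (act h x)"
  using action by (simp add: lifted_action_def)

lemma act_less_iff: "g \<in> carrier G \<Longrightarrow> act g x < act g y \<longleftrightarrow> x < y"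
  using action by (simp add: lifted_action_def strict_mono_less)

lemma act_le_iff: "g \<in> carrier G \<Longrightarrow> act g x \<le> act g y \<longleftrightarrow> x \<le> y"
  using action by (simp add: lifted_action_def strict_mono_less_eq)

lemma act_add_1: "g \<in> carrier G \<Longrightarrow> act g (x + 1) = act g x + 1"
  using action by (simp add: lifted_action_def)

lemma act_diff_1: "g \<in> carrier G \<Longrightarrow> act g (x - 1) = act g x - 1"
  using act_add_1[of g "x - 1"] by simp

lemma act_add_int:
  assumes g: "g \<in> carrier G"
  shows "act g (x + of_int n) = act g x + of_int n"
proof (induction n rule: int_induct[where k = 0])
  case base
  show ?case by simp
next
  case (step1 i)
  have "act g (x + of_int i + 1) = act g (x + of_int i) + 1" by (rule act_add_1[OF g])
  with step1 show ?case by (simp add: add.assoc)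
next
  case (step2 i)
  have "act g (x + of_int i - 1) = act g (x + of_int i) - 1" by (rule act_diff_1[OF g])
  with step2 show ?case by (simp add: algebra_simps)
qed

lemma act_inv_cancel [simp]:
  assumes "g \<in> carrier G"
  shows "act (inv g) (act g x) = x" "act g (act (inv g) x) = x"
  using assms by (simp_all add: act_mult[symmetric])

lemma act_moebius:
  "g \<in> carrier G \<Longrightarrow> A \<in> p g \<Longrightarrow> cis (2 * pi * act g x) = moebius A (cis (2 * pi * x))"
  using action by (simp add: lifted_action_def)

lemma continuous_map_act:
  assumes "continuous_map Z T f" "continuous_map Z euclideanreal h"
  shows "continuous_map Z euclideanreal (\<lambda>z. act (f z) (h z))"
proof -
  have "continuous_map Z (prod_topology T euclideanreal) (\<lambda>z. (f z, h z))"
    using assms by (simp add: continuous_map_pairwise o_def)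
  moreover have "continuous_map (prod_topology T euclideanreal) euclideanreal (\<lambda>(g, x). act g x)"
    using action by (simp add: lifted_action_def)
  ultimately have "continuous_map Z euclideanreal ((\<lambda>(g, x). act g x) \<circ> (\<lambda>z. (f z, h z)))"
    by (rule continuous_map_compose)
  then show ?thesis by (simp add: o_def)
qed

lemma continuous_map_act_at: "continuous_map T euclideanreal (\<lambda>g. act g x)"
  by (intro continuous_map_act) auto

lemma continuous_on_act:
  assumes "g \<in> carrier G"
  shows "continuous_on S (act g)"
proof -
  have "continuous_map euclideanreal euclideanreal (\<lambda>x. act g x)"
    by (intro continuous_map_act continuous_map_const_carrier assms) auto
  then show ?thesis using continuous_on_subset by fastforce
qed

lemma act_pow_Suc: "g \<in> carrier G \<Longrightarrow> act (g [^] Suc n) x = act (g [^] n) (act g x)"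
  by (simp add: act_mult)

text \<open>The displacement \<open>g.x - x\<close> has period \<open>1\<close>, and monotonicity bounds its variation over a period by
  \<open>1\<close>. This makes \<open>n \<mapsto> g^n.0\<close> quasi-additive and the limit independent of the base point.\<close>

lemma displacement_variation:
  assumes g: "g \<in> carrier G"
  shows "\<bar>(act g x - x) - act g 0\<bar> \<le> 1"
proof -
  define r where "r = frac x"
  have r: "0 \<le> r" "r < 1" "x = r + of_int \<lfloor>x\<rfloor>" 
    unfolding r_def using frac_ge_0[of x] frac_lt_1[of x] by (auto simp: frac_def)
  have "act g x = act g r + of_int \<lfloor>x\<rfloor>" using act_add_int[OF g] r(3) by metis
  moreover have "act g 0 \<le> act g r" "act g r < act g (0 + 1)"
    using r g by (simp_all add: act_le_iff act_less_iff)
  moreover have "act g (0 + 1) = act g 0 + 1" by (rule act_add_1[OF g])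
  ultimately show ?thesis using r by linarith
qed

lemma translation_number_properties:
  assumes g: "g \<in> carrier G"
  shows translation_number_limit:
      "(\<lambda>n. (act (g [^] n) x - x) / real n) \<longlonglongrightarrow> translation_number G act g"
    and translation_number_approx:
      "n > 0 \<Longrightarrow> \<bar>act (g [^] n) 0 / real n - translation_number G act g\<bar> \<le> 1 / real n"
proof -
  have "\<bar>act (g [^] (m + n)) 0 - act (g [^] m) 0 - act (g [^] n) 0\<bar> \<le> 1" for m n :: nat
  proof -
    have "act (g [^] (m + n)) 0 = act (g [^] m) (act (g [^] n) 0)"
      using g by (simp add: nat_pow_mult[symmetric] act_mult)
    then show ?thesis 
      using displacement_variation[OF nat_pow_closed[OF g, of m], of "act (g [^] n) 0"] by linarith
  qed
  then obtain t where approx: "\<And>n. n > 0 \<Longrightarrow> \<bar>act (g [^] n) 0 / real n - t\<bar> \<le> 1 / real n"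
    and lim: "(\<lambda>n. act (g [^] n) 0 / real n) \<longlonglongrightarrow> t"
    by (rule quasi_additive_limit[where a = "\<lambda>n. act (g [^] n) 0"]) blast
  have lim_x: "(\<lambda>n. (act (g [^] n) y - y) / real n) \<longlonglongrightarrow> t" for y
  proof -
    have "(\<lambda>n. (act (g [^] n) y - y) / real n - act (g [^] n) 0 / real n) \<longlonglongrightarrow> 0"
    proof (rule Lim_null_comparison[OF _ lim_1_over_n], rule always_eventually, rule allI)
      fix n
      have "\<bar>(act (g [^] n) y - y) - act (g [^] n) 0\<bar> / real n \<le> 1 / real n"
        using displacement_variation[of "g [^] n" y] g by (intro divide_right_mono) auto
      then show "norm ((act (g [^] n) y - y) / real n - act (g [^] n) 0 / real n) \<le> 1 / real n"
        by (simp add: diff_divide_distrib[symmetric] abs_divide)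
    qed
    from tendsto_add[OF this lim] show ?thesis by simp
  qed
  have "translation_number G act g = t"
    unfolding translation_number_def
  proof (rule the_equality)
    show "t' = t" if "\<forall>x. (\<lambda>n. (act (g [^] n) x - x) / real n) \<longlonglongrightarrow> t'" for t'
      using that lim_x LIMSEQ_unique by blast
  qed (use lim_x in blast)
  with lim_x approx
  show "(\<lambda>n. (act (g [^] n) x - x) / real n) \<longlonglongrightarrow> translation_number G act g"
    "n > 0 \<Longrightarrow> \<bar>act (g [^] n) 0 / real n - translation_number G act g\<bar> \<le> 1 / real n"
    by auto
qed

text \<open>The functions \<open>g \<mapsto> g^n.0 / n\<close> are continuous and within \<open>1/n\<close> of the translation number,
  uniformly in \<open>g\<close>.\<close>

lemma continuous_map_translation_number:
  "continuous_map T euclideanreal (translation_number G act)"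
proof -
  have "continuous_map T Met_TC.mtopology (translation_number G act)"
  proof (rule Met_TC.continuous_map_uniform_limit[where F = sequentially
        and f = "\<lambda>n g. act (g [^] n) 0 / real n"])
    show "\<forall>\<^sub>F n in sequentially. continuous_map T Met_TC.mtopology (\<lambda>g. act (g [^] n) 0 / real n)"
      unfolding mtopology_is_euclidean divide_inverse
      by (intro always_eventually allI continuous_map_real_mult continuous_map_act continuous_map_nat_pow) auto
    fix \<epsilon> :: real assume "\<epsilon> > 0"
    then obtain N :: nat where N: "N > 0" "1 / real N < \<epsilon>"
      using nat_approx_posE by (metis zero_less_Suc)
    have "dist (act (g [^] n) 0 / real n) (translation_number G act g) < \<epsilon>"
      if "n \<ge> N" "g \<in> carrier G" for n g
    proof -
      have "1 / real n \<le> 1 / real N" using that N by (simp add: frac_le)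
      with translation_number_approx[OF that(2), of n] that N show ?thesis
        unfolding dist_real_def by linarith
    qed
    then show "\<forall>\<^sub>F n in sequentially. \<forall>g\<in>topspace T. translation_number G act g \<in> UNIV \<and>
        dist (act (g [^] n) 0 / real n) (translation_number G act g) < \<epsilon>"
      unfolding eventually_sequentially topspace_eq by blast
  qed simp
  then show ?thesis by (simp add: mtopology_is_euclidean)
qed

lemma translation_number_mono:
  assumes gh: "g \<in> carrier G" "h \<in> carrier G" and le: "\<And>x. act g x \<le> act h x"
  shows "translation_number G act g \<le> translation_number G act h"
proof (rule LIMSEQ_le[OF translation_number_limit[OF gh(1), of 0] translation_number_limit[OF gh(2), of 0]])
  have "act (g [^] n) x \<le> act (h [^] n) x" for n :: nat and x
  proof (induction n arbitrary: x)
    case (Suc n)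
    have "act (g [^] n) (act g x) \<le> act (g [^] n) (act h x)"
      using le gh by (simp add: act_le_iff)
    also have "\<dots> \<le> act (h [^] n) (act h x)" by (rule Suc)
    finally show ?case using gh by (simp only: act_pow_Suc)
  qed simp
  then show "\<exists>N. \<forall>n\<ge>N. (act (g [^] n) 0 - 0) / real n \<le> (act (h [^] n) 0 - 0) / real n"
    by (simp add: divide_right_mono)
qed

lemma translation_number_fixed_point:
  assumes g: "g \<in> carrier G" and fix_a: "act g a = a"
  shows "translation_number G act g = 0"
proof -
  have "act (g [^] n) a = a" for n :: nat
    by (induction n) (simp_all only: act_pow_Suc[OF g] fix_a nat_pow_0 act_one)
  then have "(\<lambda>n. 0 :: real) \<longlonglongrightarrow> translation_number G act g"
    using translation_number_limit[OF g, of a] by simp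
  then show ?thesis using LIMSEQ_unique tendsto_const by blast
qed

lemma act_pow_le:
  assumes g: "g \<in> carrier G" and le: "act g x \<le> x - 1"
  shows "act (g [^] (n::nat)) x \<le> x - real n"
proof (induction n)
  case (Suc n)
  have "act (g [^] n) (act g x) \<le> act (g [^] n) (x - 1)"
    using le g by (simp add: act_le_iff)
  also have "\<dots> = act (g [^] n) x - 1" using g by (simp add: act_diff_1)
  finally show ?case using Suc g by (simp only: act_pow_Suc)
qed simp

lemma translation_number_le_minus_1:
  assumes g: "g \<in> carrier G" and le: "act g x \<le> x - 1"
  shows "translation_number G act g \<le> - 1"
proof (rule LIMSEQ_le_const2[OF translation_number_limit[OF g, of x]])
  have "(act (g [^] n) x - x) / real n \<le> - 1" if "n \<ge> 1" for n
    using act_pow_le[OF g le, of n] that by (simp add: divide_le_eq)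
  then show "\<exists>N. \<forall>n\<ge>N. (act (g [^] n) x - x) / real n \<le> - 1" by blast
qed

end

section \<open>The Iwasawa decomposition of the covering group\<close>

lemma integer_valued_continuous_constant:
  fixes f :: "real \<Rightarrow> real"
  assumes "continuous_on UNIV f" "\<And>t. f t \<in> \<int>"
  shows "f t = f 0"
proof -
  have "f constant_on UNIV"
  proof (rule continuous_discrete_range_constant)
    show "\<exists>e>0. \<forall>y. y \<in> UNIV \<and> f y \<noteq> f x \<longrightarrow> e \<le> norm (f y - f x)" for x
    proof (intro exI[of _ 1] conjI allI impI)
      fix y assume y: "y \<in> UNIV \<and> f y \<noteq> f x"
      have "f y - f x \<in> \<int>" using assms(2) by simp
      then have "1 \<le> \<bar>f y - f x\<bar>" using y by (intro Ints_nonzero_abs_ge1) auto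
      then show "1 \<le> norm (f y - f x)" by simp
    qed simp
  qed (use assms in auto)
  then show ?thesis by (auto simp: constant_on_def)
qed

lemma cis_eq_1_imp_Ints:
  assumes "cis (2 * pi * x) = 1"
  shows "x \<in> \<int>"
proof -
  have "cos (2 * pi * x) = 1" using assms by (metis cis.sel(1) one_complex.sel(1))
  then obtain n :: int where "2 * pi * x = of_int n * 2 * pi" using cos_one_2pi_int by auto
  then have "x = of_int n" by simp
  then show ?thesis by simp
qed

lemma boost_shear:
  "boost s ** shear u =
     mat22 (of_real (cosh s) + \<i> * of_real (u * exp s)) (of_real (sinh s) - \<i> * of_real (u * exp s))
       (of_real (sinh s) + \<i> * of_real (u * exp s)) (of_real (cosh s) - \<i> * of_real (u * exp s))"
proof -
  have "complex_of_real (cosh s) + complex_of_real (sinh s) = complex_of_real (exp s)"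
    by (metis cosh_plus_sinh of_real_add)
  then have e: "complex_of_real (exp s) = complex_of_real (cosh s) + complex_of_real (sinh s)" ..
  show ?thesis
    unfolding boost_def shear_def mat22_mult mat22_eq_iff of_real_mult e by (simp add: algebra_simps)
qed

text \<open>The vector \<open>(1, 1)\<close> is isotropic for the hermitian form, and so is its image under \<open>A\<close>. If the first
  entry of the image vanished, then so would the second, although \<open>A\<close> is invertible.\<close>

lemma U11_image_of_1_nonzero:
  assumes "A \<in> carrier U11"
  shows "A $ 1 $ 1 + A $ 1 $ 2 \<noteq> 0"
proof
  assume 0: "A $ 1 $ 1 + A $ 1 $ 2 = 0"
  define a b c d where abcd: "a = A $ 1 $ 1" "b = A $ 1 $ 2" "c = A $ 2 $ 1" "d = A $ 2 $ 2"
  have "mat22 a b c d \<in> carrier U11" using assms by (simp add: abcd mat22_eta)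
  then have eqs: "cnj a * a - cnj c * c = 1" "cnj a * b = cnj c * d" "cnj b * a = cnj d * c"
    "cnj b * b - cnj d * d = - 1"
    by (auto simp: carrier_U11_mat22)
  have b: "b = - a" using 0 by (simp add: abcd eq_neg_iff_add_eq_0 add.commute)
  have "cnj (c + d) * (c + d) = cnj c * c + cnj c * d + cnj d * c + cnj d * d"
    by (simp add: algebra_simps)
  also have "\<dots> = 0"
  proof -
    have "cnj a * a - cnj d * d = - 1" using eqs(4) by (simp add: b)
    moreover have "- (cnj a * a) = cnj c * d" "- (cnj a * a) = cnj d * c"
      using eqs(2,3) by (simp_all add: b)
    ultimately show ?thesis using eqs(1) by algebra
  qed
  finally have "c + d = 0" by (simp only: mult_eq_0_iff complex_cnj_zero_iff disj_absorb)
  then have d: "d = - c" by (simp add: eq_neg_iff_add_eq_0 add.commute)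
  from eqs(1,2) show False unfolding b d by simp
qed

text \<open>The two Iwasawa parameters of the stabilizer of \<open>1\<close>, read off from any matrix of a coset.\<close>

definition boost_param :: "complex^2^2 \<Rightarrow> real" where
  "boost_param A = ln (cmod (A $ 1 $ 1 + A $ 1 $ 2))"

definition shear_param :: "complex^2^2 \<Rightarrow> real" where
  "shear_param A = Im (A $ 1 $ 1 * cnj (A $ 1 $ 1 + A $ 1 $ 2)) / (cmod (A $ 1 $ 1 + A $ 1 $ 2))\<^sup>2"

lemma scalar_mult_nth: "(mat c ** A) $ i $ j = c * A $ i $ j" for A :: "complex^2^2"
  by (simp add: matrix_matrix_mult_def mat_def sum_2 exhaust_2 if_distrib if_distribR)
    (metis (no_types, opaque_lifting) add.right_neutral add_0 exhaust_2 mult_zero_left)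

lemma params_scalar_mult:
  assumes "cmod c = 1"
  shows "boost_param (mat c ** A) = boost_param A" "shear_param (mat c ** A) = shear_param A"
proof -
  have cc: "c * cnj c = 1" using assms by (simp add: complex_norm_square[symmetric])
  have prod: "c * x * cnj (c * y) = x * cnj y" for x y
  proof -
    have "c * x * cnj (c * y) = (c * cnj c) * (x * cnj y)" by (simp add: mult_ac)
    then show ?thesis by (simp add: cc)
  qed
  show "boost_param (mat c ** A) = boost_param A"
    unfolding boost_param_def scalar_mult_nth distrib_left[symmetric] by (simp only: norm_mult assms mult_1)
  show "shear_param (mat c ** A) = shear_param A"
    unfolding shear_param_def scalar_mult_nth distrib_left[symmetric] prod by (simp only: norm_mult assms mult_1)
qed

lemma continuous_on_params:
  "continuous_on (carrier U11) boost_param" "continuous_on (carrier U11) shear_param"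
  unfolding boost_param_def shear_param_def
  by (intro continuous_intros; simp add: U11_image_of_1_nonzero)+

text \<open>After multiplying by a scalar of modulus \<open>1\<close>, the matrix has \<open>(1, 1)\<close> as an eigenvector with an
  eigenvalue \<open>\<rho> > 0\<close>. The equations of \<open>U(1,1)\<close> then determine everything except \<open>\<rho>\<close> and the imaginary part of the
  upper left entry, which are \<open>e^s\<close> and \<open>u e^s\<close> for a boost by \<open>s\<close> times a shear by \<open>u\<close>.\<close>

lemma iwasawa_stabilizer:
  assumes A: "A \<in> carrier U11" and fix1: "A $ 1 $ 1 + A $ 1 $ 2 = A $ 2 $ 1 + A $ 2 $ 2"
  shows "coset (boost (boost_param A) ** shear (shear_param A)) = coset A"
proof -
  define c where "c = sgn (A $ 1 $ 1 + A $ 1 $ 2)"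
  have c: "cmod c = 1" using U11_image_of_1_nonzero[OF A] by (simp add: c_def norm_sgn)
  define B where "B = mat (cnj c) ** A"
  have cnj_c: "cmod (cnj c) = 1" using c by simp
  have B_in: "B \<in> carrier U11"
  proof -
    have "mat (cnj c) \<in> U11_scalars" using cnj_c unfolding U11_scalars_def by blast
    then have "mat (cnj c) \<in> carrier U11" using scalars.subset by blast
    from U11.m_closed[OF this A] show ?thesis by (simp add: B_def)
  qed
  define \<rho> where "\<rho> = cmod (A $ 1 $ 1 + A $ 1 $ 2)"
  have \<rho>: "\<rho> > 0" using U11_image_of_1_nonzero[OF A] by (simp add: \<rho>_def)
  have c\<rho>: "cnj c * (A $ 1 $ 1 + A $ 1 $ 2) = of_real \<rho>"
  proof -
    have "A $ 1 $ 1 + A $ 1 $ 2 = c * of_real \<rho>"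
      using \<rho> by (simp add: c_def \<rho>_def sgn_eq)
    moreover have "cnj c * c = 1" using c by (metis complex_norm_square mult.commute of_real_1 one_power2)
    ultimately show ?thesis by (simp add: mult.assoc[symmetric])
  qed
  define a d where "a = B $ 1 $ 1" and "d = B $ 2 $ 2"
  have row1: "B $ 1 $ 2 = of_real \<rho> - a" and row2: "B $ 2 $ 1 = of_real \<rho> - d"
    unfolding B_def a_def d_def scalar_mult_nth c\<rho>[symmetric]
    by (simp add: distrib_left) (simp add: fix1 distrib_left)
  have "mat22 a (of_real \<rho> - a) (of_real \<rho> - d) d \<in> carrier U11"
    using B_in mat22_eta[of B] by (simp add: row1 row2 a_def d_def)
  then have eqs: "cnj a * a - cnj (of_real \<rho> - d) * (of_real \<rho> - d) = 1"
    "cnj a * (of_real \<rho> - a) = cnj (of_real \<rho> - d) * d"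
    by (auto simp: carrier_U11_mat22)
  have *: "of_real \<rho> * (cnj a - d) = cnj a * a - cnj d * d"
    using eqs(2) by (simp add: algebra_simps)
  have **: "cnj a * a - cnj d * d = 1 + of_real \<rho> * of_real \<rho> - of_real \<rho> * d - of_real \<rho> * cnj d"
    using eqs(1) by (simp add: algebra_simps)
  have Im_eq: "Im d = - Im a" 
  proof -
    have "\<rho> * (Im d + Im a) = 0" using arg_cong[OF *, of Im] by (simp add: algebra_simps)
    then show ?thesis using \<rho> by auto
  qed
  have Re1: "\<rho> * (Re a - Re d) = (Re a)\<^sup>2 - (Re d)\<^sup>2"
    using arg_cong[OF *, of Re] Im_eq by (simp add: algebra_simps power2_eq_square)
  have Re2: "\<rho> * (Re a - Re d) = 1 + \<rho> * \<rho> - 2 * \<rho> * Re d"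
    using arg_cong[OF *, of Re] arg_cong[OF **, of Re] by (simp add: algebra_simps)
  have "Re a = Re d"
  proof (rule ccontr)
    assume "Re a \<noteq> Re d"
    with Re1 have "\<rho> = Re a + Re d" by (simp add: power2_eq_square square_diff_square_factored mult.commute)
    with Re2 show False by (simp add: algebra_simps)
  qed
  with Re2 have Re_a: "Re a = (1 + \<rho> * \<rho>) / (2 * \<rho>)" using \<rho> by (simp add: field_simps)
  define s where "s = boost_param A"
  define u where "u = shear_param A"
  have exp_s: "exp s = \<rho>" using \<rho> by (simp add: s_def boost_param_def \<rho>_def)
  have cosh_s: "cosh s = Re a" and sinh_s: "sinh s = \<rho> - Re a"
    using \<rho> by (simp_all add: cosh_def sinh_def exp_s exp_minus Re_a field_simps)
  have u: "u * \<rho> = Im a"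
  proof -
    have "u = shear_param B" unfolding u_def B_def using params_scalar_mult(2)[OF cnj_c] by simp
    also have "\<dots> = Im a / \<rho>"
      using \<rho> by (simp add: shear_param_def row1 a_def[symmetric] power2_eq_square)
    finally show ?thesis using \<rho> by simp
  qed
  have "boost s ** shear u = B"
  proof -
    have "B = mat22 a (of_real \<rho> - a) (of_real \<rho> - d) d"
      using mat22_eta[of B] by (simp add: row1 row2 a_def d_def)
    moreover have "complex_of_real (cosh s) + \<i> * of_real (u * exp s) = a"
      using u by (simp add: complex_eq_iff exp_s cosh_s)
    moreover have "complex_of_real (cosh s) - \<i> * of_real (u * exp s) = d"
      using u Im_eq \<open>Re a = Re d\<close> by (simp add: complex_eq_iff exp_s cosh_s)
    moreover have "complex_of_real (sinh s) - \<i> * of_real (u * exp s) = of_real \<rho> - a"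
      using u by (simp add: complex_eq_iff exp_s sinh_s)
    moreover have "complex_of_real (sinh s) + \<i> * of_real (u * exp s) = of_real \<rho> - d"
      using u Im_eq \<open>Re a = Re d\<close> by (simp add: complex_eq_iff exp_s sinh_s)
    ultimately show ?thesis by (simp add: boost_shear)
  qed
  then show ?thesis using coset_scalar_mult[OF A cnj_c] by (simp add: s_def u_def B_def)
qed

text \<open>The point \<open>cis (2\<pi>x)\<close> is \<open>w / cnj w\<close> with \<open>w = cis (\<pi>x)\<close>, and a matrix of this shape maps it to
  \<open>v / cnj v\<close>, where \<open>v\<close> is the first entry of its value at \<open>(w, cnj w)\<close>. Hence \<open>v\<close> is a real multiple of
  \<open>cis (\<pi>y)\<close>: an equation in which no quotient occurs.\<close>

lemma moebius_cis:
  assumes "A $ 2 $ 1 = cnj (A $ 1 $ 2)" "A $ 2 $ 2 = cnj (A $ 1 $ 1)"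
    and eq: "cis (2 * pi * y) = moebius A (cis (2 * pi * x))"
  shows "Im ((A $ 1 $ 1 * cis (pi * x) + A $ 1 $ 2 * cis (- (pi * x))) * cis (- (pi * y))) = 0"
proof -
  define v where "v = A $ 1 $ 1 * cis (pi * x) + A $ 1 $ 2 * cis (- (pi * x))"
  have double: "cis (2 * pi * x) = cis (pi * x) * cis (pi * x)" for x by (simp add: cis_mult mult.assoc)
  have inv: "cis (pi * x) * cis (- (pi * x)) = 1" for x by (simp add: cis_mult)
  have factor: "a * (w * w) + b = w * (a * w + b * w')" "b * (w * w) + a = w * (a * w' + b * w)"
    if "w * w' = 1" for a b w w' :: complex
    using that by algebra+
  have num: "A $ 1 $ 1 * cis (2 * pi * x) + A $ 1 $ 2 = cis (pi * x) * v"
    unfolding v_def double by (rule factor(1)[OF inv])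
  have den: "A $ 2 $ 1 * cis (2 * pi * x) + A $ 2 $ 2 = cis (pi * x) * cnj v"
    unfolding v_def double assms(1,2) using factor(2)[OF inv] by (simp add: cis_cnj)
  have "cis (2 * pi * y) = v / cnj v"
    using eq by (simp add: moebius_def num den)
  then have "cis (pi * y) * cis (pi * y) * cnj v = v" by (cases "v = 0") (auto simp: double)
  then have "cis (pi * y) * cis (pi * y) * cnj v * cis (- (pi * y)) = v * cis (- (pi * y))" by simp
  then have "cnj (v * cis (- (pi * y))) = v * cis (- (pi * y))"
    using inv[of y] by (simp add: cis_cnj mult.assoc mult.left_commute mult.commute)
  then show ?thesis unfolding v_def[symmetric] by (metis cnj.sel(2) neg_equal_zero)
qed

context pu11_cover
begin

lemma connected_T: "connected_space T"
proof -
  have sc: "simply_connected_space T" using cover by (simp add: universal_covering_group_def)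
  have "path_connected_space T"
    unfolding path_connected_space_def
  proof (intro ballI)
    fix a b assume ab: "a \<in> topspace T" "b \<in> topspace T"
    then have "pathin T (\<lambda>_. a)" "pathin T (\<lambda>_. b)" by (auto simp: pathin_const)
    then have "homotopic_with (\<lambda>r. r 1 = r 0) (top_of_set {0..1::real}) T (\<lambda>_. a) (\<lambda>_. b)"
      using sc unfolding simply_connected_space_def by blast
    then obtain h where h: "continuous_map (prod_topology (top_of_set {0..1::real}) (top_of_set {0..1::real})) T h"
      "\<And>x. h (0, x) = a" "\<And>x. h (1, x) = b"
      unfolding homotopic_with_def by blast
    have "continuous_map (top_of_set {0..1}) (prod_topology (top_of_set {0..1}) (top_of_set {0..1::real})) (\<lambda>t. (t, 0::real))"
      by (simp add: continuous_map_pairwise o_def continuous_intros)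
    from continuous_map_compose[OF this h(1)] have "pathin T (\<lambda>t. h (t, 0))"
      by (simp add: pathin_def o_def)
    then show "\<exists>g. pathin T g \<and> g 0 = a \<and> g 1 = b" using h by blast
  qed
  then show ?thesis by (rule path_connected_imp_connected_space)
qed

text \<open>For a continuous homomorphism \<open>M\<close> into \<open>U(1,1)\<close> there is exactly one choice, by uniqueness of
  lifts.\<close>

definition lifted :: "(real \<Rightarrow> complex^2^2) \<Rightarrow> real \<Rightarrow> 'g" where
  "lifted M = (SOME \<gamma>. one_parameter_subgroup G T \<gamma> \<and> (\<forall>t. p (\<gamma> t) = coset (M t)))"

lemma lifted:
  assumes "continuous_on UNIV M" "\<And>t. M t \<in> carrier U11" "\<And>s t. M (s + t) = M s ** M t"
  shows "one_parameter_subgroup G T (lifted M)" "p (lifted M t) = coset (M t)"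
proof -
  obtain \<gamma> where \<gamma>: "one_parameter_subgroup G T \<gamma>" "\<And>t. p (\<gamma> t) = coset (M t)"
  proof (rule one_parameter_subgroup_lift[of "\<lambda>t. coset (M t)"])
    show "continuous_map euclideanreal PU11_topology (\<lambda>t. coset (M t))"
      by (rule continuous_map_coset_comp[OF assms(1,2)])
    show "coset (M (s + t)) = coset (M s) \<otimes>\<^bsub>PU11\<^esub> coset (M t)" for s t
      using assms by (simp add: coset_mult)
  qed blast
  then have "\<exists>\<gamma>. one_parameter_subgroup G T \<gamma> \<and> (\<forall>t. p (\<gamma> t) = coset (M t))" by blast
  from someI_ex[OF this] show "one_parameter_subgroup G T (lifted M)" "p (lifted M t) = coset (M t)"
    unfolding lifted_def by blast+
qed

abbreviation "rotG \<equiv> lifted rot"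
abbreviation "boostG \<equiv> lifted boost"
abbreviation "shearG \<equiv> lifted shear"

lemmas rotG = lifted[OF continuous_on_rot rot_in_U11 rot_add]
lemmas boostG = lifted[OF continuous_on_boost boost_in_U11 boost_add]
lemmas shearG = lifted[OF continuous_on_shear shear_in_U11 shear_add]

lemma lifted_closed [simp]: "rotG t \<in> carrier G" "boostG t \<in> carrier G" "shearG t \<in> carrier G"
  using rotG(1) boostG(1) shearG(1) by (auto intro: one_parameter_subgroup_carrier)

lemma lifted_0 [simp]: "rotG 0 = \<one>" "boostG 0 = \<one>" "shearG 0 = \<one>"
  using rotG(1) boostG(1) shearG(1) by (auto intro: one_parameter_subgroup_0)

lemma continuous_map_lifted:
  assumes "continuous_map Z euclideanreal f"
  shows "continuous_map Z T (\<lambda>z. rotG (f z))" "continuous_map Z T (\<lambda>z. boostG (f z))"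
    "continuous_map Z T (\<lambda>z. shearG (f z))"
  using continuous_map_compose[OF assms] rotG(1) boostG(1) shearG(1)
  unfolding one_parameter_subgroup_def o_def by blast+

lemma cis_act:
  assumes "g \<in> carrier G" "p g = coset A" "A \<in> carrier U11"
  shows "cis (2 * pi * act g x) = moebius A (cis (2 * pi * x))"
  using act_moebius assms mem_coset_self by simp

lemma continuous_on_act_lifted:
  assumes "continuous_map euclideanreal T \<gamma>"
  shows "continuous_on UNIV (\<lambda>t. act (\<gamma> t) x)"
  using continuous_map_act[OF assms, of "\<lambda>_. x"] by simp

text \<open>The two sides differ by an integer that depends continuously on \<open>t\<close> and vanishes at \<open>t = 0\<close>. The
  same argument shows below that lifts of one-parameter groups fixing \<open>1\<close> fix \<open>0\<close>, not merely its class
  modulo integers.\<close>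

lemma act_rotG [simp]: "act (rotG t) x = x + t"
proof -
  let ?f = "\<lambda>t. act (rotG t) x - x - t"
  have "?f t = ?f 0"
  proof (rule integer_valued_continuous_constant[of ?f])
    show "continuous_on UNIV ?f"
      using rotG(1) by (intro continuous_intros continuous_on_act_lifted) (simp add: one_parameter_subgroup_def)
    fix t
    have "cis (2 * pi * act (rotG t) x) = cis (pi * t) * cis (2 * pi * x) / cis (- (pi * t))"
      using cis_act[OF _ rotG(2) rot_in_U11, of t x] by (simp add: moebius_rot)
    also have "\<dots> = cis (2 * pi * x + 2 * pi * t)" by (simp add: cis_mult cis_divide algebra_simps)
    finally have "cis (2 * pi * act (rotG t) x - (2 * pi * x + 2 * pi * t)) = 1"
      by (simp add: cis_divide[symmetric])
    then show "?f t \<in> \<int>"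
      by (intro cis_eq_1_imp_Ints) (simp add: algebra_simps)
  qed
  then show ?thesis by simp
qed

lemma lifted_fixes_0:
  assumes \<gamma>: "one_parameter_subgroup G T \<gamma>" "\<And>t. p (\<gamma> t) = coset (M t)" and M: "\<And>t. M t \<in> carrier U11"
    and fix1: "\<And>t. moebius (M t) 1 = 1"
  shows "act (\<gamma> t) 0 = 0"
proof -
  have "act (\<gamma> t) 0 = act (\<gamma> 0) 0"
  proof (rule integer_valued_continuous_constant[of "\<lambda>t. act (\<gamma> t) 0"])
    show "continuous_on UNIV (\<lambda>t. act (\<gamma> t) 0)"
      using \<gamma>(1) by (intro continuous_on_act_lifted) (simp add: one_parameter_subgroup_def)
    fix t
    have "cis (2 * pi * act (\<gamma> t) 0) = 1"
      using cis_act[OF one_parameter_subgroup_carrier[OF \<gamma>(1)] \<gamma>(2) M, of t 0] fix1 by simp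
    then show "act (\<gamma> t) 0 \<in> \<int>" by (rule cis_eq_1_imp_Ints)
  qed
  then show ?thesis using one_parameter_subgroup_0[OF \<gamma>(1)] by simp
qed

lemma act_boostG_0 [simp]: "act (boostG t) 0 = 0"
  by (rule lifted_fixes_0[OF boostG boost_in_U11 moebius_boost_1])

lemma act_shearG_0 [simp]: "act (shearG t) 0 = 0"
  by (rule lifted_fixes_0[OF shearG shear_in_U11 moebius_shear_1])

lemma p_boost_shear: "p (boostG s \<otimes> shearG u) = coset (boost s ** shear u)"
  using boost_in_U11 shear_in_U11 by (simp add: boostG shearG coset_mult)

text \<open>After the rotation part is split off, the boost and shear parameters can be read off from
  \<open>p\<close>, and both they and \<open>g.0\<close> are continuous in \<open>g\<close>. So both sides are continuous lifts of \<open>p\<close> that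
  agree at the unit, and \<open>G\<close> is connected.\<close>

lemma iwasawa_decomposition:
  assumes g: "g \<in> carrier G"
  obtains s u where "g = rotG (act g 0) \<otimes> (boostG s \<otimes> shearG u)"
proof -
  define bp where "bp = (\<lambda>a. boost_param (SOME A. A \<in> a))"
  define sp where "sp = (\<lambda>a. shear_param (SOME A. A \<in> a))"
  have some: "(SOME B. B \<in> coset A) \<in> coset A" if "A \<in> carrier U11" for A
    using mem_coset_self[OF that] by (rule someI)
  have param: "bp (coset A) = boost_param A \<and> sp (coset A) = shear_param A" if A: "A \<in> carrier U11" for A
  proof -
    let ?B = "SOME B. B \<in> coset A"
    have B: "?B \<in> carrier U11" "coset A = coset ?B"
      using mem_PU11[OF coset_in_PU11[OF A] some[OF A]] by auto
    obtain c where "cmod c = 1" "?B = mat c ** A"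
      using coset_eq_scalar_multiple[OF A B(2) B(1)] by blast
    then show ?thesis unfolding bp_def sp_def by (simp add: params_scalar_mult)
  qed
  have cont_bp: "continuous_map PU11_topology euclideanreal bp"
    by (rule continuous_map_from_PU11[OF continuous_on_params(1)]) (simp add: param)
  have cont_sp: "continuous_map PU11_topology euclideanreal sp"
    by (rule continuous_map_from_PU11[OF continuous_on_params(2)]) (simp add: param)
  have cont_p: "continuous_map T PU11_topology p" using covering by (simp add: covering_map_def)
  define r where "r = (\<lambda>g. inv (rotG (act g 0)) \<otimes> g)"
  define \<Psi> where "\<Psi> = (\<lambda>g. rotG (act g 0) \<otimes> (boostG (bp (p (r g))) \<otimes> shearG (sp (p (r g)))))"
  have cont_r: "continuous_map T T r"
    unfolding r_def
    by (intro continuous_map_mult continuous_map_inv continuous_map_lifted continuous_map_act_at)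
      (simp add: continuous_map_id[unfolded id_def])
  have cont_pr: "continuous_map T euclideanreal (\<lambda>g. bp (p (r g)))" "continuous_map T euclideanreal (\<lambda>g. sp (p (r g)))"
    using continuous_map_compose[OF continuous_map_compose[OF cont_r cont_p] cont_bp]
      continuous_map_compose[OF continuous_map_compose[OF cont_r cont_p] cont_sp]
    by (simp_all add: o_def)
  have "g = \<Psi> g"
  proof (rule lift_unique[OF connected_T, of "\<lambda>g. g" \<Psi> \<one>])
    show "continuous_map T T \<Psi>"
      unfolding \<Psi>_def
      by (intro continuous_map_mult continuous_map_lifted continuous_map_act_at cont_pr)
    show "\<one> = \<Psi> \<one>"
    proof -
      have "p \<one> = coset (mat 1)" by (simp add: coset_one)
      moreover have "mat 1 \<in> carrier U11" using U11.one_closed by simp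
      ultimately have "bp (p \<one>) = 0" "sp (p \<one>) = 0"
        using param[of "mat 1"] by (simp_all add: boost_param_def shear_param_def mat_def)
      then show ?thesis by (simp add: \<Psi>_def r_def)
    qed
    fix x assume "x \<in> topspace T"
    then have x: "x \<in> carrier G" by (simp add: topspace_eq)
    then have rx: "r x \<in> carrier G" by (simp add: r_def)
    have "act (r x) 0 = act (inv (rotG (act x 0))) (act x 0)" using x by (simp add: r_def act_mult)
    also have "\<dots> = 0"
      using act_inv_cancel(1)[of "rotG (act x 0)" 0] by simp
    finally have r0: "act (r x) 0 = 0" .
    obtain A where A: "A \<in> carrier U11" "p (r x) = coset A"
      using carrier_PU11E[OF hom_closed[OF rx]] by blast
    have "moebius A 1 = 1" using cis_act[OF rx A(2,1), of 0] r0 by simp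
    then have "A $ 1 $ 1 + A $ 1 $ 2 = A $ 2 $ 1 + A $ 2 $ 2" by (auto simp: moebius_def)
    then have "p (boostG (bp (p (r x))) \<otimes> shearG (sp (p (r x)))) = p (r x)"
      using iwasawa_stabilizer[OF A(1)] param[OF A(1)] A(2) p_boost_shear by simp
    then have "p (\<Psi> x) = p (rotG (act x 0)) \<otimes>\<^bsub>PU11\<^esub> p (r x)" by (simp add: \<Psi>_def)
    also have "\<dots> = p (rotG (act x 0) \<otimes> r x)" using rx by simp
    also have "rotG (act x 0) \<otimes> r x = x" using x by (simp add: r_def m_assoc[symmetric])
    finally show "p x = p (\<Psi> x)" ..
  qed (use g in \<open>auto simp: topspace_eq continuous_map_id[unfolded id_def]\<close>)
  then show thesis unfolding \<Psi>_def by (rule that)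
qed

text \<open>With \<open>cot\<close> this reads \<open>cot (\<pi>y) = e^(2s) (cot (\<pi>x) - 2u)\<close>: in the coordinate \<open>cot (\<pi>x)\<close> the stabilizer of
  \<open>0\<close> acts by affine maps. The form without quotients holds for every \<open>x\<close>.\<close>

lemma act_stabilizer:
  fixes s u x
  defines "y \<equiv> act (boostG s \<otimes> shearG u) x"
  shows "cos (pi * y) * exp (- s) * sin (pi * x) = sin (pi * y) * exp s * (cos (pi * x) - 2 * u * sin (pi * x))"
proof -
  let ?A = "boost s ** shear u"
  have in_U: "?A \<in> carrier U11" using U11.m_closed[OF boost_in_U11 shear_in_U11] by simp
  have "Im ((?A $ 1 $ 1 * cis (pi * x) + ?A $ 1 $ 2 * cis (- (pi * x))) * cis (- (pi * y))) = 0"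
  proof (rule moebius_cis)
    show "cis (2 * pi * y) = moebius ?A (cis (2 * pi * x))"
      unfolding y_def by (rule cis_act[OF _ p_boost_shear in_U]) simp
  qed (simp_all add: boost_shear)
  then have "(cosh s - sinh s) * sin (pi * x) * cos (pi * y) =
      ((cosh s + sinh s) * cos (pi * x) - 2 * u * exp s * sin (pi * x)) * sin (pi * y)"
    by (simp add: boost_shear algebra_simps)
  then show ?thesis
    unfolding cosh_minus_sinh cosh_plus_sinh by (simp add: algebra_simps)
qed

text \<open>Nonnegativity turns into an inequality on \<open>]0, 1[\<close> that extends to the endpoints by continuity.
  At \<open>0\<close> and \<open>1\<close> it forces \<open>e^(2s) = 1\<close>, and at \<open>1/2\<close> it gives \<open>u \<ge> 0\<close>.\<close>

lemma nonneg_stabilizer: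
  assumes g: "g \<in> carrier G" and fix0: "act g 0 = 0" and nonneg: "\<And>x. act g x \<ge> x"
  obtains u where "u \<ge> 0" "g = shearG u"
proof -
  obtain s u where su: "g = boostG s \<otimes> shearG u"
    using iwasawa_decomposition[OF g] fix0 by (auto simp del: lifted_closed simp: lifted_closed)
  have act1: "act g 1 = 1" using act_add_1[OF g, of 0] fix0 by simp
  have key: "exp s * exp s * (cos (pi * x) - 2 * u * sin (pi * x)) \<le> cos (pi * x)" if x: "x \<in> {0<..<1}" for x
  proof -
    define y where "y = act g x"
    have y: "x \<le> y" "y < 1" using nonneg act_less_iff[OF g, of x 1] act1 x by (auto simp: y_def)
    have "exp s * (cos (pi * y) * exp (- s) * sin (pi * x)) =
        exp s * (sin (pi * y) * exp s * (cos (pi * x) - 2 * u * sin (pi * x)))"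
      unfolding y_def su using act_stabilizer by simp
    then have eq: "cos (pi * y) * sin (pi * x) = sin (pi * y) * (exp s * exp s * (cos (pi * x) - 2 * u * sin (pi * x)))"
      by (simp add: exp_minus field_simps)
    have "0 \<le> pi * (y - x)" "pi * (y - x) \<le> pi" using x y by (auto intro: mult_left_le)
    then have "0 \<le> sin (pi * (y - x))" by (rule sin_ge_zero)
    then have "cos (pi * y) * sin (pi * x) \<le> sin (pi * y) * cos (pi * x)"
      by (simp add: right_diff_distrib sin_diff)
    with eq have "sin (pi * y) * (exp s * exp s * (cos (pi * x) - 2 * u * sin (pi * x))) \<le> sin (pi * y) * cos (pi * x)"
      by simp
    moreover have "sin (pi * y) > 0" using x y by (intro sin_gt_zero) auto
    ultimately show ?thesis by simp
  qed
  have key': "exp s * exp s * (cos (pi * x) - 2 * u * sin (pi * x)) \<le> cos (pi * x)" if x: "x \<in> {0..1}" for x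
  proof (rule continuous_le_on_closure[where S = "{0<..<1::real}"
        and f = "\<lambda>x. exp s * exp s * (cos (pi * x) - 2 * u * sin (pi * x)) - cos (pi * x)" and a = 0 and x = x, simplified])
  qed (use x key in \<open>auto intro!: continuous_intros\<close>)
  have "exp s * exp s \<le> 1" using key'[of 0] by simp
  moreover have "exp s * exp s \<ge> 1" using key'[of 1] by simp
  ultimately have "exp (s + s) = 1" unfolding exp_add by simp
  then have "s + s = 0" by (simp only: exp_eq_one_iff)
  then have s: "s = 0" by simp
  have "u \<ge> 0" using key'[of "1/2"] by (simp add: s)
  moreover have "g = shearG u" by (simp add: su s)
  ultimately show thesis by (rule that)
qed

text \<open>In the coordinate \<open>cot (\<pi>x)\<close> on \<open>]-1, 0[\<close> the shear by \<open>- t\<close> is the translation by \<open>2t\<close>,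
  so that a suitable shear takes \<open>x\<close> exactly to \<open>y\<close>.\<close>

lemma push_down_fixing_0:
  assumes x: "- 1 < x" "x < 0" and y: "- 1 < y" "y < 0"
  obtains h where "h \<in> carrier G" "act h 0 = 0" "act h x \<le> y"
proof -
  have neg: "sin (pi * z) < 0" if "- 1 < z" "z < 0" for z
  proof -
    have "0 < pi * (- z)" using that by (intro mult_pos_pos) auto
    moreover have "pi * (- z) < pi * 1" using that by (intro mult_strict_left_mono) auto
    ultimately have "sin (pi * (- z)) > 0" by (intro sin_gt_zero) auto
    then show ?thesis by simp
  qed
  define t where "t = (cot (pi * y) - cot (pi * x)) / 2"
  define h where "h = shearG (- t)"
  define z where "z = act h x"
  have h: "h \<in> carrier G" "act h 0 = 0" by (simp_all add: h_def)
  have z: "- 1 < z" "z < 0"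
    using act_less_iff[OF h(1), of "-1" x] act_less_iff[OF h(1), of x 0] act_diff_1[OF h(1), of 0] h x
    by (simp_all add: z_def)
  have "h = boostG 0 \<otimes> shearG (- t)" by (simp add: h_def)
  then have "cos (pi * z) * sin (pi * x) = sin (pi * z) * (cos (pi * x) + 2 * t * sin (pi * x))"
    using act_stabilizer[of 0 "- t" x] by (simp add: z_def)
  then have "cot (pi * z) = cot (pi * x) + 2 * t"
    using neg[OF x] neg[OF z] by (simp add: cot_def field_simps)
  also have "\<dots> = cot (pi * y)" by (simp add: t_def diff_divide_distrib)
  finally have "sin (pi * z - pi * y) = 0"
    using neg[OF y] neg[OF z] by (simp add: cot_def field_simps sin_diff)
  then have "sin (pi * (z - y)) = 0" by (simp add: right_diff_distrib)
  moreover have "\<bar>pi * (z - y)\<bar> < pi"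
  proof -
    have "pi * \<bar>z - y\<bar> < pi * 1" using y z by (intro mult_strict_left_mono) auto
    then show ?thesis by (simp add: abs_mult)
  qed
  ultimately have "z = y" using sin_zero_pi_iff[of "pi * (z - y)"] by simp
  then show thesis using that[OF h] by (simp add: z_def)
qed

text \<open>This is what shows that a \<open>g\<close> with \<open>g.x < x\<close> can be made to lower points by a whole turn: take \<open>a\<close>
  between \<open>g.x\<close> and \<open>x\<close>. The element is a shear conjugated by the rotation taking \<open>0\<close> to \<open>a\<close>.\<close>

lemma push_down:
  assumes "x < a" "a < c"
  obtains h where "h \<in> carrier G" "act h a = a" "act h x \<le> c - 1"
proof -
  \<comment> \<open>Moving \<open>x\<close> up and \<open>c\<close> down only strengthens the claim and brings both into the period below \<open>a\<close>.\<close>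
  define x' where "x' = max (x - a) (- 1 / 2)"
  define y where "y = min (c - a) (1 / 2) - 1"
  have "- 1 < x'" "x' < 0" "- 1 < y" "y < 0" using assms by (auto simp: x'_def y_def)
  then obtain h where h: "h \<in> carrier G" "act h 0 = 0" "act h x' \<le> y" by (rule push_down_fixing_0)
  define k where "k = rotG a \<otimes> (h \<otimes> rotG (- a))"
  have act_k: "act k z = act h (z - a) + a" for z using h by (simp add: k_def act_mult)
  have "act h (x - a) \<le> act h x'" using h by (simp add: act_le_iff x'_def)
  also have "\<dots> \<le> c - a - 1" using h(3) by (simp add: y_def)
  finally have "act k x \<le> c - 1" by (simp add: act_k)
  moreover have "k \<in> carrier G" "act k a = a" using h by (simp_all add: k_def act_k[unfolded k_def])
  ultimately show thesis using that by blast
qed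

end

section \<open>Invariant cones in \<open>su(1,1)\<close>\<close>

lemma su11_mat22:
  assumes "X \<in> su11"
  obtains a b where "X = mat22 (\<i> * of_real a) b (cnj b) (- (\<i> * of_real a))"
proof -
  define x y z w where xyzw: "x = X $ 1 $ 1" "y = X $ 1 $ 2" "z = X $ 2 $ 1" "w = X $ 2 $ 2"
  have X: "X = mat22 x y z w" by (simp add: xyzw mat22_eta)
  have eq: "mat_adj X ** J11 + J11 ** X = 0" and tr: "trace X = 0" using assms by (auto simp: su11_def)
  have "cnj x + x = 0" "- cnj z + y = 0"
    using eq unfolding X J11_eq_mat22 mat_adj_mat22 mat22_mult mat22_add mat22_0[symmetric] mat22_eq_iff
    by simp_all
  then have "Re x = 0" and z: "z = cnj y" by (auto simp: complex_eq_iff)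
  then have x: "x = \<i> * of_real (Im x)" by (simp add: complex_eq_iff)
  have "w = - x" using tr by (simp add: X trace_def sum_2 eq_neg_iff_add_eq_0 add.commute)
  with X x z that[of "Im x" y] show thesis by metis
qed

context pu11_cover
begin

text \<open>The definite description in the definition of the exponential is resolved by uniqueness of lifts.\<close>

lemma lie_exp_eqI:
  assumes "one_parameter_subgroup G T \<gamma>" "\<And>t. p (\<gamma> t) = coset (mat_exp (t *\<^sub>R X))"
  shows "lie_exp G T p X = \<gamma> 1"
  unfolding lie_exp_def
proof (rule the_equality)
  fix g assume "\<exists>\<gamma>'. one_parameter_subgroup G T \<gamma>' \<and> (\<forall>t. p (\<gamma>' t) = coset (mat_exp (t *\<^sub>R X))) \<and> g = \<gamma>' 1"
  then obtain \<gamma>' where "one_parameter_subgroup G T \<gamma>'" "\<And>t. p (\<gamma>' t) = coset (mat_exp (t *\<^sub>R X))" "g = \<gamma>' 1"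
    by blast
  then show "g = \<gamma> 1" using one_parameter_subgroup_unique[of \<gamma>' \<gamma>] assms by metis
qed (use assms in blast)

lemma one_parameter_subgroup_scale:
  assumes "one_parameter_subgroup G T \<gamma>"
  shows "one_parameter_subgroup G T (\<lambda>t. \<gamma> (t * r))"
proof -
  have "continuous_map euclideanreal euclideanreal (\<lambda>t. t * r)" by (simp add: continuous_intros)
  then have "continuous_map euclideanreal T (\<gamma> \<circ> (\<lambda>t. t * r))"
    using assms unfolding one_parameter_subgroup_def by (blast intro: continuous_map_compose)
  then show ?thesis using assms by (simp add: one_parameter_subgroup_def o_def distrib_right)
qed

lemma one_parameter_subgroup_conj:
  assumes \<gamma>: "one_parameter_subgroup G T \<gamma>" and k: "k \<in> carrier G"
  shows "one_parameter_subgroup G T (\<lambda>t. k \<otimes> \<gamma> t \<otimes> inv k)"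
  unfolding one_parameter_subgroup_def
proof (intro conjI allI)
  show "continuous_map euclideanreal T (\<lambda>t. k \<otimes> \<gamma> t \<otimes> inv k)"
    using \<gamma> k unfolding one_parameter_subgroup_def
    by (intro continuous_map_mult continuous_map_const_carrier) auto
  fix s t
  have in_G: "\<gamma> s \<in> carrier G" "\<gamma> t \<in> carrier G" using one_parameter_subgroup_carrier[OF \<gamma>] by auto
  have "\<gamma> (s + t) = \<gamma> s \<otimes> \<gamma> t" using \<gamma> by (simp add: one_parameter_subgroup_def)
  then show "k \<otimes> \<gamma> (s + t) \<otimes> inv k = k \<otimes> \<gamma> s \<otimes> inv k \<otimes> (k \<otimes> \<gamma> t \<otimes> inv k)"
    using in_G k inv_solve_left[of "\<gamma> t \<otimes> inv k" k "k \<otimes> (\<gamma> t \<otimes> inv k)"] by (simp add: m_assoc)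
qed

lemma inv_rotG: "inv (rotG t) = rotG (- t)"
  using one_parameter_subgroup_inv[OF rotG(1)] .

lemma rotG_mult_minus: "rotG t \<otimes> rotG (- t) = \<one>" "rotG (- t) \<otimes> rotG t = \<one>"
  by (simp_all add: inv_rotG[symmetric])

lemma lie_exp_rot_gen: "lie_exp G T p (r *\<^sub>R rot_gen) = rotG r"
  using lie_exp_eqI[OF one_parameter_subgroup_scale[OF rotG(1), of r], of "r *\<^sub>R rot_gen"]
  by (simp add: rotG(2) mat_exp_rot_gen)

lemma rot_inverse: "rot (- a) ** rot a = mat 1" "rot a ** rot (- a) = mat 1"
  by (simp_all add: rot_add[symmetric]) (simp_all add: rot_def mat_eq_mat22)

lemma lie_exp_conj_shear_gen:
  "lie_exp G T p (rot a ** (u *\<^sub>R shear_gen) ** rot (- a)) = rotG a \<otimes> shearG u \<otimes> rotG (- a)"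
proof -
  have in_U: "rot a ** shear v \<in> carrier U11" for v
    using U11.m_closed[OF rot_in_U11 shear_in_U11] by simp
  have "one_parameter_subgroup G T (\<lambda>t. rotG a \<otimes> shearG (t * u) \<otimes> inv (rotG a))"
    by (intro one_parameter_subgroup_conj one_parameter_subgroup_scale shearG) simp
  moreover have "p (rotG a \<otimes> shearG (t * u) \<otimes> inv (rotG a)) =
      coset (mat_exp (t *\<^sub>R (rot a ** (u *\<^sub>R shear_gen) ** rot (- a))))" for t
    using in_U rot_in_U11 shear_in_U11
    by (simp add: mat_exp_conj_shear_gen rot_inverse inv_rotG rotG(2) shearG(2) coset_mult del: hom_inv)
  ultimately have "lie_exp G T p (rot a ** (u *\<^sub>R shear_gen) ** rot (- a)) = rotG a \<otimes> shearG (1 * u) \<otimes> inv (rotG a)"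
    by (rule lie_exp_eqI)
  then show ?thesis by (simp add: inv_rotG)
qed

end

locale pu11_cone = pu11_cover +
  fixes C :: "(complex^2^2) set"
  assumes cone: "invariant_cone G p C"
begin

lemma cone_add: "X \<in> C \<Longrightarrow> Y \<in> C \<Longrightarrow> X + Y \<in> C"
  and cone_scaleR: "X \<in> C \<Longrightarrow> r \<ge> 0 \<Longrightarrow> r *\<^sub>R X \<in> C"
  using cone convex_cone[of C] by (auto simp: invariant_cone_def)

lemma cone_conj:
  assumes A: "A \<in> carrier U11" and AB: "A ** B = mat 1" and X: "X \<in> C"
  shows "A ** X ** B \<in> C"
proof -
  have "coset A \<in> p ` topspace T"
    using covering coset_in_PU11[OF A] by (simp add: covering_map_def topspace_PU11)
  then obtain g where g: "g \<in> carrier G" "p g = coset A" by (auto simp: topspace_eq)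
  then have *: "A ** X ** matrix_inv A \<in> C"
    using cone X mem_coset_self[OF A] by (auto simp: invariant_cone_def Ad_invariant_def)
  have BA: "B ** A = mat 1" using AB by (simp add: matrix_left_right_inverse)
  have "A ** matrix_inv A = mat 1 \<and> matrix_inv A ** A = mat 1"
    unfolding matrix_inv_def using AB BA by (intro someI[of "\<lambda>A'. A ** A' = mat 1 \<and> A' ** A = mat 1" B]) simp
  then have "matrix_inv A = matrix_inv A ** (A ** B)" "matrix_inv A ** A = mat 1" using AB by simp_all
  then have "matrix_inv A = B" by (metis matrix_mul_assoc matrix_mul_lid)
  with * show ?thesis by simp
qed

text \<open>Adding the conjugate by the rotation by a half turn kills the off-diagonal entries; what remains
  is nonzero because the cone is pointed.\<close>

lemma cone_contains_rot_gen: "rot_gen \<in> C \<or> - rot_gen \<in> C"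
proof -
  have pointed: "C \<inter> uminus ` C = {0}" and "C \<noteq> {0}" and su: "C \<subseteq> su11"
    using cone by (auto simp: invariant_cone_def)
  then obtain X where X: "X \<in> C" "X \<noteq> 0" by blast
  with su obtain a b where X_eq: "X = mat22 (\<i> * of_real a) b (cnj b) (- (\<i> * of_real a))"
    using su11_mat22 by blast
  let ?Y = "mat22 (\<i> * of_real a) (- b) (- cnj b) (- (\<i> * of_real a))"
  have rot_half: "rot (1 / 2) = mat22 \<i> 0 0 (- \<i>)" "rot (- (1 / 2)) = mat22 (- \<i>) 0 0 \<i>"
    by (simp_all add: rot_def mat22_eq_iff complex_eq_iff)
  have "rot (1 / 2) ** X ** rot (- (1 / 2)) \<in> C"
    by (rule cone_conj[OF rot_in_U11 rot_inverse(2) X(1)])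
  also have "rot (1 / 2) ** X ** rot (- (1 / 2)) = ?Y"
    unfolding rot_half X_eq mat22_mult mat22_eq_iff by (simp add: algebra_simps)
  finally have Y: "?Y \<in> C" .
  have "a \<noteq> 0"
  proof
    assume "a = 0"
    then have "X = - ?Y" by (simp add: X_eq mat22_uminus mat22_eq_iff)
    with X Y pointed show False by blast
  qed
  have XY: "X + ?Y = (2 * a / pi) *\<^sub>R rot_gen"
    unfolding X_eq mat22_add rot_gen_def mat22_scaleR mat22_eq_iff
    by (simp add: scaleR_conv_of_real field_simps)
  have XY_in: "X + ?Y \<in> C" using X Y by (intro cone_add)
  have "(pi / (2 * \<bar>a\<bar>)) *\<^sub>R (X + ?Y) \<in> C" by (rule cone_scaleR[OF XY_in]) simp
  then have "(a / \<bar>a\<bar>) *\<^sub>R rot_gen \<in> C" using \<open>a \<noteq> 0\<close> unfolding XY by simp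
  then show ?thesis using \<open>a \<noteq> 0\<close> by (cases "a > 0") simp_all
qed

text \<open>Conjugating the generator of the rotations by a boost by \<open>s\<close> and rescaling gives a matrix with
  entries \<open>\<i>\<close> and \<open>\<i> tanh (2s)\<close> up to sign, which tends to the generator of the shears.\<close>

lemma cone_contains_shear_gen:
  assumes "rot_gen \<in> C"
  shows "shear_gen \<in> C"
proof -
  define f where "f = (\<lambda>\<tau>::real. mat22 \<i> (- (\<i> * of_real \<tau>)) (\<i> * of_real \<tau>) (- \<i>))"
  have f_in: "f (tanh (2 * s)) \<in> C" for s
  proof -
    have boost_inv: "boost s ** boost (- s) = mat 1"
      by (simp add: boost_add[symmetric]) (simp add: boost_def mat_eq_mat22)
    have "boost s ** rot_gen ** boost (- s) \<in> C"
      by (rule cone_conj[OF boost_in_U11 boost_inv assms])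
    then have "(1 / (pi * cosh (2 * s))) *\<^sub>R (boost s ** rot_gen ** boost (- s)) \<in> C"
      by (rule cone_scaleR) simp
    also have "(1 / (pi * cosh (2 * s))) *\<^sub>R (boost s ** rot_gen ** boost (- s)) = f (tanh (2 * s))"
    proof -
      have c: "complex_of_real (cosh (2 * s)) = of_real (cosh s) * of_real (cosh s) + of_real (sinh s) * of_real (sinh s)"
        by (simp only: cosh_double power2_eq_square of_real_add of_real_mult)
      have sh: "complex_of_real (sinh (2 * s)) = 2 * of_real (sinh s) * of_real (cosh s)"
        by (simp only: sinh_double of_real_mult of_real_numeral)
      have "boost s ** rot_gen ** boost (- s) =
          mat22 (\<i> * pi * of_real (cosh (2 * s))) (- (\<i> * pi * of_real (sinh (2 * s))))
                (\<i> * pi * of_real (sinh (2 * s))) (- (\<i> * pi * of_real (cosh (2 * s))))"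
        unfolding boost_def rot_gen_def mat22_mult mat22_eq_iff c sh by (simp add: algebra_simps)
      moreover have "cosh (2 * s) \<noteq> 0" by simp
      ultimately show ?thesis
        unfolding f_def mat22_scaleR mat22_eq_iff
        by (simp only: mat22_scaleR mat22_eq_iff tanh_def)
          (simp add: scaleR_conv_of_real field_simps)
    qed
    finally show ?thesis .
  qed
  have "filterlim (\<lambda>n. 2 * real n) at_top sequentially"
    by (intro filterlim_tendsto_pos_mult_at_top[OF tendsto_const] filterlim_real_sequentially) simp
  then have tanh: "(\<lambda>n. tanh (2 * real n)) \<longlonglongrightarrow> 1"
    by (rule filterlim_compose[OF tanh_real_at_top])
  have "continuous_on UNIV f" unfolding f_def by (intro continuous_on_mat22 continuous_intros)
  then have "isCont f 1" by (simp add: continuous_on_eq_continuous_at)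
  from isCont_tendsto_compose[OF this tanh] have "(\<lambda>n. f (tanh (2 * real n))) \<longlonglongrightarrow> f 1" .
  moreover have "closed C" using cone by (simp add: invariant_cone_def)
  ultimately have "f 1 \<in> C" using f_in closed_sequentially[of C "\<lambda>n. f (tanh (2 * real n))"] by blast
  then show ?thesis by (simp add: f_def shear_gen_def)
qed

end

section \<open>Comparison of the order semigroups\<close>

context pu11_cover
begin

definition nonneg_elements :: "'g set" where
  "nonneg_elements = {g \<in> carrier G. \<forall>x. act g x \<ge> x}"

lemma order_semigroup_geometric: "order_semigroup G (geometric_order G act) = nonneg_elements"
  by (auto simp: order_semigroup_def geometric_order_def nonneg_elements_def)

lemma geometric_order_eq: "geometric_order G act = order_of_semigroup G nonneg_elements"
proof -
  have "(\<forall>x. act h x \<le> act g x) \<longleftrightarrow> (\<forall>x. x \<le> act (inv h \<otimes> g) x)"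
    if "h \<in> carrier G" "g \<in> carrier G" for h g
    using that act_le_iff[OF that(1), of _ "act (inv h \<otimes> g) _"] by (simp add: act_mult)
  then show ?thesis
    by (auto simp: geometric_order_def order_of_semigroup_def nonneg_elements_def)
qed

lemma nonneg_elements_mult:
  assumes "g \<in> nonneg_elements" "h \<in> nonneg_elements"
  shows "g \<otimes> h \<in> nonneg_elements"
proof -
  have "x \<le> act g (act h x)" for x
    using assms order.trans[of x "act h x"] by (simp add: nonneg_elements_def)
  then show ?thesis using assms by (simp add: nonneg_elements_def act_mult)
qed

lemma nonneg_elements_conj:
  assumes "g \<in> nonneg_elements" "k \<in> carrier G"
  shows "k \<otimes> g \<otimes> inv k \<in> nonneg_elements"
proof -
  have g: "g \<in> carrier G" "\<And>x. x \<le> act g x" using assms by (auto simp: nonneg_elements_def)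
  have "x \<le> act k (act g (act (inv k) x))" for x
    using g(2)[of "act (inv k) x"] act_le_iff[OF assms(2), of "act (inv k) x"] assms(2) by simp
  then show ?thesis using g assms(2) by (simp add: nonneg_elements_def act_mult)
qed

lemma closedin_nonneg_elements: "closedin T nonneg_elements"
proof -
  have "closedin T (\<Inter>x. {g \<in> topspace T. act g x \<in> {x..}})"
    by (intro closedin_INT closedin_continuous_map_preimage[OF continuous_map_act_at]) auto
  moreover have "(\<Inter>x. {g \<in> topspace T. act g x \<in> {x..}}) = nonneg_elements"
    by (auto simp: nonneg_elements_def topspace_eq)
  ultimately show ?thesis by simp
qed

text \<open>If \<open>g\<close> moves \<open>x\<close> down, then \<open>h\<close> can be chosen with a fixed point between \<open>g.x\<close> and \<open>x\<close>,
  hence of translation number \<open>0\<close>, and such that \<open>hg\<close> moves \<open>x\<close> down by a full turn.\<close>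

lemma maximal_semigroup_eq: "maximal_semigroup G act = nonneg_elements"
proof
  show "maximal_semigroup G act \<subseteq> nonneg_elements"
  proof
    fix g assume "g \<in> maximal_semigroup G act"
    then have g: "g \<in> carrier G"
      and T: "\<And>h. h \<in> carrier G \<Longrightarrow> translation_number G act h \<le> translation_number G act (h \<otimes> g)"
      by (auto simp: maximal_semigroup_def)
    have "x \<le> act g x" for x
    proof (rule ccontr)
      assume "\<not> x \<le> act g x"
      then obtain a where a: "act g x < a" "a < x" using dense[of "act g x" x] by auto
      from push_down[OF this] obtain h where h: "h \<in> carrier G" "act h a = a" "act h (act g x) \<le> x - 1"
        by blast
      then have "translation_number G act (h \<otimes> g) \<le> - 1"
        using g by (intro translation_number_le_minus_1[of _ x]) (simp_all add: act_mult)
      moreover have "translation_number G act h = 0" using h by (intro translation_number_fixed_point)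
      ultimately show False using T[OF h(1)] by simp
    qed
    with g show "g \<in> nonneg_elements" by (simp add: nonneg_elements_def)
  qed
  show "nonneg_elements \<subseteq> maximal_semigroup G act"
    by (auto simp: nonneg_elements_def maximal_semigroup_def act_mult act_le_iff
        intro!: translation_number_mono)
qed

text \<open>Up to a rotation by its minimal displacement and a conjugation by a rotation, a nonnegative
  element fixes \<open>0\<close>, and then it is a shear.\<close>

lemma nonneg_element_factorization:
  assumes "g \<in> nonneg_elements"
  obtains m a u where "m \<ge> 0" "u \<ge> 0" "g = rotG m \<otimes> (rotG a \<otimes> shearG u \<otimes> rotG (- a))"
proof -
  have g: "g \<in> carrier G" "\<And>x. x \<le> act g x" using assms by (auto simp: nonneg_elements_def)
  have "continuous_on {0..1} (\<lambda>x. act g x - x)" by (intro continuous_intros continuous_on_act g)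
  then obtain a where a: "\<forall>x\<in>{0..1}. act g a - a \<le> act g x - x"
    using continuous_attains_inf[of "{0..1::real}" "\<lambda>x. act g x - x"] by auto
  define m where "m = act g a - a"
  have m_le: "m \<le> act g x - x" for x
  proof -
    have "frac x \<in> {0..1}" using frac_ge_0[of x] frac_lt_1[of x] by auto
    then have "m \<le> act g (frac x) - frac x" using a by (simp add: m_def)
    also have "act g (frac x + of_int \<lfloor>x\<rfloor>) = act g (frac x) + of_int \<lfloor>x\<rfloor>" by (rule act_add_int[OF g(1)])
    then have "act g (frac x) - frac x = act g x - x" by (simp add: frac_def)
    finally show ?thesis .
  qed
  define h where "h = rotG (- a) \<otimes> (rotG (- m) \<otimes> (g \<otimes> rotG a))"
  have h: "h \<in> carrier G" using g by (simp add: h_def)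
  have act_h: "act h x = act g (x + a) - m - a" for x using g by (simp add: h_def act_mult)
  have "act h 0 = 0" by (simp add: act_h m_def)
  moreover have "x \<le> act h x" for x using m_le[of "x + a"] by (simp add: act_h)
  ultimately obtain u where u: "u \<ge> 0" "h = shearG u" using nonneg_stabilizer[OF h] by blast
  have cancel: "rotG t \<otimes> (rotG (- t) \<otimes> x) = x" if "x \<in> carrier G" for t x
    using that by (simp add: m_assoc[symmetric] rotG_mult_minus)
  have "rotG m \<otimes> (rotG a \<otimes> h \<otimes> rotG (- a)) = g \<otimes> (rotG a \<otimes> rotG (- a))"
    using g by (simp add: h_def m_assoc cancel)
  also have "\<dots> = g" using g by (simp add: rotG_mult_minus)
  finally have "g = rotG m \<otimes> (rotG a \<otimes> shearG u \<otimes> rotG (- a))" using u by simp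
  moreover have "m \<ge> 0" using g(2)[of a] by (simp add: m_def)
  ultimately show thesis using that u by blast
qed

text \<open>An element of \<open>S\<close> that is not nonnegative moves some point down. A conjugate of it moves a point
  \<open>v\<close> down by at least half a turn, to \<open>w\<close>; its conjugate by the rotation taking \<open>v\<close> to \<open>w\<close> moves \<open>w\<close> down by
  the same amount, and their product \<open>k\<close> moves \<open>v\<close> down by a full turn. The powers of \<open>k\<close> get below any
  given \<open>f\<close>, so that \<open>f\<close> is such a power times a nonnegative element.\<close>

lemma conj_invariant_subsemigroup_eq_carrier:
  assumes S: "conj_invariant_subsemigroup G S" and sub: "nonneg_elements \<subseteq> S" and g: "g \<in> S" "g \<notin> nonneg_elements"
  shows "S = carrier G"
proof -
  have S_sub: "S \<subseteq> carrier G" and S_mult: "\<And>x y. x \<in> S \<Longrightarrow> y \<in> S \<Longrightarrow> x \<otimes> y \<in> S"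
    and S_conj: "\<And>k x. k \<in> carrier G \<Longrightarrow> x \<in> S \<Longrightarrow> k \<otimes> x \<otimes> inv k \<in> S"
    using S by (auto simp: conj_invariant_subsemigroup_def)
  have gG: "g \<in> carrier G" using g S_sub by blast
  with g obtain x where x: "act g x < x" by (auto simp: nonneg_elements_def not_le)
  then obtain a where a: "act g x < a" "a < x" using dense by blast
  \<comment> \<open>Since \<open>h.x\<close> stays above \<open>a\<close>, the bound \<open>a - 1/2\<close> makes the conjugate of \<open>g\<close> move it by half a turn.\<close>
  then obtain h where h: "h \<in> carrier G" "act h a = a" "act h (act g x) \<le> (a + 1 / 2) - 1"
    using push_down[of "act g x" a "a + 1 / 2"] by auto
  define v where "v = act h x"
  define w where "w = act h (act g x)"
  have "a < v" using act_less_iff[OF h(1), of a x] a h by (simp add: v_def)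
  with h have vw: "w \<le> v - 1 / 2" by (simp add: w_def)
  define g1 where "g1 = h \<otimes> g \<otimes> inv h"
  have g1: "g1 \<in> S" "g1 \<in> carrier G" using S_conj[OF h(1) g(1)] S_sub by (auto simp: g1_def)
  have g1_v: "act g1 v = w" using gG h by (simp add: g1_def v_def w_def act_mult)
  define g2 where "g2 = rotG (w - v) \<otimes> g1 \<otimes> inv (rotG (w - v))"
  have g2: "g2 \<in> S" "g2 \<in> carrier G" using S_conj[OF _ g1(1), of "rotG (w - v)"] S_sub by (auto simp: g2_def)
  have g2_w: "act g2 w = w + (w - v)"
    using g1 g1_v by (simp add: g2_def act_mult inv_rotG)
  define k where "k = g2 \<otimes> g1"
  have k: "k \<in> S" "k \<in> carrier G" using S_mult[OF g2(1) g1(1)] S_sub by (auto simp: k_def)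
  have k_v: "act k v \<le> v - 1" using vw g1 g2 by (simp add: k_def act_mult g1_v g2_w)
  have "f \<in> S" if f: "f \<in> carrier G" for f
  proof -
    obtain n :: nat where n: "2 - act f 0 < real n" using reals_Archimedean2 by blast
    have n': "act (k [^] Suc n) x \<le> act f x" for x
    proof -
      have kn: "k [^] Suc n \<in> carrier G" using k by simp
      have "act (k [^] Suc n) v \<le> v - real (Suc n)" by (rule act_pow_le[OF k(2) k_v])
      moreover have "\<bar>(act (k [^] Suc n) v - v) - act (k [^] Suc n) 0\<bar> \<le> 1"
        "\<bar>(act (k [^] Suc n) x - x) - act (k [^] Suc n) 0\<bar> \<le> 1" "\<bar>(act f x - x) - act f 0\<bar> \<le> 1"
        using displacement_variation kn f by blast+
      ultimately show ?thesis using n unfolding of_nat_Suc by linarith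
    qed
    have kS: "k [^] Suc n \<in> S" for n
    proof (induction n)
      case (Suc n)
      then show ?case using S_mult[OF Suc k(1)] by simp
    qed (use k in simp)
    define q where "q = inv (k [^] Suc n) \<otimes> f"
    have kn: "k [^] Suc n \<in> carrier G" using k by simp
    have "x \<le> act q x" for x
      using n'[of x] act_le_iff[OF kn, of x "act q x"] kn f by (simp add: q_def act_mult del: nat_pow_Suc)
    then have "q \<in> S" using sub kn f by (auto simp: nonneg_elements_def q_def)
    moreover have "f = k [^] Suc n \<otimes> q" using kn f by (simp add: q_def m_assoc[symmetric] del: nat_pow_Suc)
    ultimately show ?thesis using kS S_mult by metis
  qed
  with S_sub show ?thesis by blast
qed

lemma maximal_conj_invariant_nonneg_elements:
  "maximal_conj_invariant_subsemigroup G nonneg_elements"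
  unfolding maximal_conj_invariant_subsemigroup_def
proof (intro conjI notI)
  show "conj_invariant_subsemigroup G nonneg_elements"
    unfolding conj_invariant_subsemigroup_def
    using nonneg_elements_mult nonneg_elements_conj by (auto simp: nonneg_elements_def)
  assume "nonneg_elements = carrier G"
  then have "rotG (- 1) \<in> nonneg_elements" by simp
  then have "0 \<le> act (rotG (- 1)) 0" by (auto simp: nonneg_elements_def simp del: act_rotG)
  then show False by simp
next
  assume "\<exists>S'. conj_invariant_subsemigroup G S' \<and> nonneg_elements \<subset> S' \<and> S' \<subset> carrier G"
  then show False using conj_invariant_subsemigroup_eq_carrier by blast
qed

end

text \<open>The assumption on \<open>exp(C)\<close> fixes the sign of the cone: the exponential of \<open>- rot_gen\<close> is the
  translation by \<open>-1\<close>, which is not nonnegative.\<close>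

lemma (in pu11_cone) lie_semigroup_eq:
  assumes exp_C: "lie_exp G T p ` C \<subseteq> nonneg_elements"
  shows "lie_semigroup G T p C = nonneg_elements"
proof
  let ?S = "generated_subsemigroup G (lie_exp G T p ` C)"
  have "?S \<subseteq> nonneg_elements"
  proof
    fix g assume "g \<in> ?S"
    then show "g \<in> nonneg_elements"
      by induction (use exp_C nonneg_elements_mult in auto)
  qed
  then show "lie_semigroup G T p C \<subseteq> nonneg_elements"
    unfolding lie_semigroup_def by (rule closure_of_minimal[OF _ closedin_nonneg_elements])
  have "rot_gen \<in> C"
  proof (rule ccontr)
    assume "rot_gen \<notin> C"
    then have "(- 1) *\<^sub>R rot_gen \<in> C" using cone_contains_rot_gen by simp
    then have "rotG (- 1) \<in> nonneg_elements" using exp_C lie_exp_rot_gen[of "- 1"] by auto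
    then have "0 \<le> act (rotG (- 1)) 0" by (auto simp: nonneg_elements_def simp del: act_rotG)
    then show False by simp
  qed
  have "nonneg_elements \<subseteq> ?S"
  proof
    fix g assume "g \<in> nonneg_elements"
    then obtain m a u where mu: "m \<ge> 0" "u \<ge> 0" and g: "g = rotG m \<otimes> (rotG a \<otimes> shearG u \<otimes> rotG (- a))"
      by (rule nonneg_element_factorization)
    have "m *\<^sub>R rot_gen \<in> C" using \<open>rot_gen \<in> C\<close> mu by (intro cone_scaleR)
    then have "rotG m \<in> ?S"
      using lie_exp_rot_gen[of m] by (intro generated_subsemigroup.base) (metis imageI)
    moreover have "rot a ** (u *\<^sub>R shear_gen) ** rot (- a) \<in> C"
      by (intro cone_conj rot_in_U11 rot_inverse cone_scaleR cone_contains_shear_gen \<open>rot_gen \<in> C\<close> mu)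
    then have "rotG a \<otimes> shearG u \<otimes> rotG (- a) \<in> ?S"
      using lie_exp_conj_shear_gen[of a u] by (intro generated_subsemigroup.base) (metis imageI)
    ultimately show "g \<in> ?S" unfolding g by (rule generated_subsemigroup.mult)
  qed
  also have "?S \<subseteq> T closure_of ?S"
    using \<open>?S \<subseteq> nonneg_elements\<close> by (intro closure_of_subset) (auto simp: nonneg_elements_def topspace_eq)
  finally show "nonneg_elements \<subseteq> lie_semigroup G T p C" unfolding lie_semigroup_def .
qed

section \<open>The three orders coincide\<close>

theorem theorem1p1:
  fixes G :: "('g, 'm) monoid_scheme"
    and T :: "'g topology"
    and p :: "'g \<Rightarrow> (complex^2^2) set"
    and act :: "'g \<Rightarrow> real \<Rightarrow> real"
    and C :: "(complex^2^2) set"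
  assumes "universal_covering_group G T PU11 PU11_topology p"
    and "lifted_action G T p act"
    and "invariant_cone G p C"
    and "lie_exp G T p ` C \<subseteq> order_semigroup G (geometric_order G act)"
  shows "geometric_order G act = lie_order G T p C \<and>
         lie_order G T p C = maximal_order G act \<and>
         {g \<in> carrier G. \<forall>x. act g x \<ge> x} = lie_semigroup G T p C \<and>
         lie_semigroup G T p C = maximal_semigroup G act \<and>
         maximal_conj_invariant_subsemigroup G (lie_semigroup G T p C) \<and>
         (\<exists>f. continuous_map T euclideanreal f \<and>
            lie_semigroup G T p C =
              {g \<in> carrier G. \<forall>h\<in>carrier G. f (h \<otimes>\<^bsub>G\<^esub> g) \<ge> f h})"
proof -
  interpret pu11_cone G T p act C
    using assms(1-3) by unfold_locales
  have lie: "lie_semigroup G T p C = nonneg_elements"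
    using assms(4) by (intro lie_semigroup_eq) (simp add: order_semigroup_geometric)
  have max: "maximal_semigroup G act = lie_semigroup G T p C"
    by (simp add: lie maximal_semigroup_eq)
  have "geometric_order G act = lie_order G T p C" "lie_order G T p C = maximal_order G act"
    by (simp_all add: geometric_order_eq lie_order_def maximal_order_def max lie)
  moreover have "maximal_conj_invariant_subsemigroup G (lie_semigroup G T p C)"
    unfolding lie by (rule maximal_conj_invariant_nonneg_elements)
  moreover have "\<exists>f. continuous_map T euclideanreal f \<and>
      lie_semigroup G T p C = {g \<in> carrier G. \<forall>h\<in>carrier G. f (h \<otimes>\<^bsub>G\<^esub> g) \<ge> f h}"
    using continuous_map_translation_number max[symmetric]
    by (intro exI[of _ "translation_number G act"] conjI) (simp_all only: maximal_semigroup_def)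
  moreover have "{g \<in> carrier G. \<forall>x. act g x \<ge> x} = lie_semigroup G T p C"
    by (simp add: lie nonneg_elements_def)
  ultimately show ?thesis using max[symmetric] by (intro conjI)
qed

end
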